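(* Let $(\mathcal{V}, \otimes, I, a, \ell, r)$ be a left skew monoidal category, let $(\mathcal{A}, *, m, u)$ be a strong left $\mathcal{V}$-action, and let $J \in \mathcal{A}$ be an object such that $J_* : \mathcal{V} \to \mathcal{A}$, $J_*X = X * J$, has a left adjoint $J_!$. Equip $\mathcal{A}$ with the induced left skew monoidal structure $(\mathcal{A},\lhd,J,\gamma,\lambda,\rho)$, $A \lhd B = J_!A * B$, described in the context. Then the adjunction $J_! \dashv J_*$ is monoidal with respect to $\lhd$ and $\otimes$; that is, the right adjoint $J_* : (\mathcal{V},\otimes,I)\to(\mathcal{A},\lhd,J)$ carries a lax monoidal structure and, correspondingly (via mates), the left adjoint $J_! : (\mathcal{A},\lhd,J)\to(\mathcal{V},\otimes,I)$ carries an oplax monoidal structure.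
   Context: A left skew monoidal category $(\mathcal{A}, \otimes, I, \gamma,\lambda,\rho)$ consists of a category $\mathcal{A}$, a functor $\otimes : \mathcal{A}\times\mathcal{A}\to\mathcal{A}$, an object $I$, and natural families of (not necessarily invertible) morphisms $\gamma_{A,B,C} : (A\otimes B)\otimes C \to A\otimes(B\otimes C)$, $\lambda_A : I\otimes A\to A$, $\rho_A : A\to A\otimes I$ such that for all objects: (1) $(A\otimes\gamma_{B,C,D})\circ\gamma_{A,B\otimes C,D}\circ(\gamma_{A,B,C}\otimes D)=\gamma_{A,B,C\otimes D}\circ\gamma_{A\otimes B,C,D}$; (2) $\gamma_{A,B,I}\circ\rho_{A\otimes B}=A\otimes\rho_B$; (3) $\lambda_{A\otimes B}\circ\gamma_{I,A,B}=\lambda_A\otimes B$; (4) $\lambda_I\circ\rho_I=\mathrm{id}_I$; (5) $(A\otimes\lambda_B)\circ\gamma_{A,I,B}\circ(\rho_A\otimes B)=\mathrm{id}_{A\otimes B}$. A strong left action of a left skew monoidal category $(\mathcal{V},\otimes,I,a,\ell,r)$ on a category $\mathcal{A}$ is a bifunctor $* : \mathcal{V}\times\mathcal{A}\to\mathcal{A}$ with natural isomorphisms $m^{X,Y}_A : (X\otimes Y)*A\to X*(Y*A)$ and $u_A : I*A\to A$ such that $(X*m^{Y,Z}_A)\circ m^{X,Y\otimes Z}_A\circ(a_{X,Y,Z}*A)=m^{X,Y}_{Z*A}\circ m^{X\otimes Y,Z}_A$; $u_{X*A}\circ m^{I,X}_A=\ell_X*A$; $(X*u_A)\circ m^{X,I}_A\circ(r_X*A)=\mathrm{id}_{X*A}$.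 Induced structure: let $\eta,\epsilon$ be the unit and counit of $J_!\dashv J_*$. The left skew monoidal structure on $\mathcal{A}$ has tensor $A\lhd B=J_!A*B$, unit $J$, and constraints $\gamma_{A,B,C}=m^{J_!A,J_!B}_C\circ(\tilde\gamma_{A,B}*C)$, $\lambda_A=u_A\circ(\epsilon_I*A)\circ(J_!(u_J^{-1})*A)$, $\rho_A=\eta_A : A\to J_!A*J$, where $\tilde\gamma_{A,B}:J_!(J_!A*B)\to J_!A\otimes J_!B$ is the adjoint transpose of $(m^{J_!A,J_!B}_J)^{-1}\circ(J_!A*\eta_B)$. A lax monoidal structure on a functor $F:(\mathcal{V},\otimes,I,a,\ell,r)\to(\mathcal{A},\lhd,J,\gamma,\lambda,\rho)$ between left skew monoidal categories consists of a natural family $\phi_{X,Y}:FX\lhd FY\to F(X\otimes Y)$ and a morphism $\iota:J\to FI$ with $\phi_{X,Y\otimes Z}\circ(FX\lhd\phi_{Y,Z})\circ\gamma_{FX,FY,FZ}=F(a_{X,Y,Z})\circ\phi_{X\otimes Y,Z}\circ(\phi_{X,Y}\lhd FZ)$; $F(\ell_X)\circ\phi_{I,X}\circ(\iota\lhd FX)=\lambda_{FX}$; $\phi_{X,I}\circ(FX\lhd\iota)\circ\rho_{FX}=F(r_X)$. An oplax monoidal structure on $G:(\mathcal{A},\lhd,J)\to(\mathcal{V},\otimes,I)$ consists of a natural family $\psi_{A,B}:G(A\lhd B)\to GA\otimes GB$ and a morphism $\psi_0:GJ\to I$ with $(GA\otimes\psi_{B,C})\circ\psi_{A,B\lhd C}\circ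 G(\gamma_{A,B,C})=a_{GA,GB,GC}\circ(\psi_{A,B}\otimes GC)\circ\psi_{A\lhd B,C}$; $\ell_{GA}\circ(\psi_0\otimes GA)\circ\psi_{J,A}=G(\lambda_A)$; $(GA\otimes\psi_0)\circ\psi_{A,J}\circ G(\rho_A)=r_{GA}$. For an adjunction $G\dashv F$ with unit $\eta$, the two structures correspond via mates if $\psi_{A,B}$ is the adjoint transpose of $\phi_{GA,GB}\circ(\eta_A\lhd\eta_B)$ and $\psi_0$ is the adjoint transpose of $\iota$. *)

theory Defs
  imports Main
begin

section \<open>Categories, functors, adjunctions\<close>

record ('o, 'a) cat =
  Obj :: "'o set"
  Arr :: "'a set"
  Dom :: "'a \<Rightarrow> 'o"
  Cod :: "'a \<Rightarrow> 'o"
  Ident :: "'o \<Rightarrow> 'a"  ("\<one>\<index>")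
  Comp :: "'a \<Rightarrow> 'a \<Rightarrow> 'a"  (infixr "\<cdot>\<index>" 55)

definition hom :: "('o, 'a, 'm) cat_scheme \<Rightarrow> 'o \<Rightarrow> 'o \<Rightarrow> 'a set" where
  "hom C X Y = {f \<in> Arr C. Dom C f = X \<and> Cod C f = Y}"

text \<open>\<open>g \<cdot> f\<close> is \<open>g\<close> after \<open>f\<close>. Values outside the carriers and on non-composable pairs are unconstrained.\<close>

locale category =
  fixes C :: "('o, 'a, 'm) cat_scheme" (structure)
  assumes Dom_in [simp]: "f \<in> Arr C \<Longrightarrow> Dom C f \<in> Obj C"
    and Cod_in [simp]: "f \<in> Arr C \<Longrightarrow> Cod C f \<in> Obj C"
    and Ident_in: "X \<in> Obj C \<Longrightarrow> \<one> X \<in> hom C X X"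
    and Comp_in: "f \<in> hom C X Y \<Longrightarrow> g \<in> hom C Y Z \<Longrightarrow> g \<cdot> f \<in> hom C X Z"
    and Comp_assoc: "f \<in> hom C W X \<Longrightarrow> g \<in> hom C X Y \<Longrightarrow> h \<in> hom C Y Z \<Longrightarrow>
      (h \<cdot> g) \<cdot> f = h \<cdot> (g \<cdot> f)"
    and Ident_left: "f \<in> hom C X Y \<Longrightarrow> \<one> Y \<cdot> f = f"
    and Ident_right: "f \<in> hom C X Y \<Longrightarrow> f \<cdot> \<one> X = f"

definition inverse_arrows :: "('o, 'a, 'm) cat_scheme \<Rightarrow> 'a \<Rightarrow> 'a \<Rightarrow> bool" where
  "inverse_arrows C f g \<longleftrightarrow>
    f \<in> Arr C \<and> g \<in> hom C (Cod C f) (Dom C f) \<and>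
    g \<cdot>\<^bsub>C\<^esub> f = \<one>\<^bsub>C\<^esub> (Dom C f) \<and> f \<cdot>\<^bsub>C\<^esub> g = \<one>\<^bsub>C\<^esub> (Cod C f)"

definition iso_arrow :: "('o, 'a, 'm) cat_scheme \<Rightarrow> 'a \<Rightarrow> bool" where
  "iso_arrow C f \<longleftrightarrow> (\<exists>g. inverse_arrows C f g)"

definition inv_arrow :: "('o, 'a, 'm) cat_scheme \<Rightarrow> 'a \<Rightarrow> 'a" where
  "inv_arrow C f = (THE g. inverse_arrows C f g)"

definition prod_cat ::
  "('o, 'a, 'm) cat_scheme \<Rightarrow> ('p, 'b, 'n) cat_scheme \<Rightarrow> ('o \<times> 'p, 'a \<times> 'b) cat" where
  "prod_cat C D =
    \<lparr>Obj = Obj C \<times> Obj D, Arr = Arr C \<times> Arr D,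
     Dom = map_prod (Dom C) (Dom D), Cod = map_prod (Cod C) (Cod D),
     Ident = map_prod (Ident C) (Ident D),
     Comp = (\<lambda>(g, g') (f, f'). (g \<cdot>\<^bsub>C\<^esub> f, g' \<cdot>\<^bsub>D\<^esub> f'))\<rparr>"

record ('o, 'a, 'p, 'b) fctr =
  omap :: "'o \<Rightarrow> 'p"
  amap :: "'a \<Rightarrow> 'b"

locale is_functor = source: category C + target: category D
  for C :: "('o, 'a, 'm) cat_scheme" and D :: "('p, 'b, 'n) cat_scheme" +
  fixes F :: "('o, 'a, 'p, 'b) fctr"
  assumes omap_in: "X \<in> Obj C \<Longrightarrow> omap F X \<in> Obj D"
    and amap_in: "f \<in> hom C X Y \<Longrightarrow> amap F f \<in> hom D (omap F X) (omap F Y)"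
    and amap_Ident: "X \<in> Obj C \<Longrightarrow> amap F (\<one>\<^bsub>C\<^esub> X) = \<one>\<^bsub>D\<^esub> (omap F X)"
    and amap_Comp: "f \<in> hom C X Y \<Longrightarrow> g \<in> hom C Y Z \<Longrightarrow>
      amap F (g \<cdot>\<^bsub>C\<^esub> f) = amap F g \<cdot>\<^bsub>D\<^esub> amap F f"

text \<open>\<open>L\<close> is left adjoint to \<open>R\<close>, with unit \<open>\<eta>\<close> and counit \<open>\<epsilon>\<close>.\<close>

locale adjunction = L: is_functor C D L + R: is_functor D C R
  for C :: "('o, 'a, 'm) cat_scheme" and D :: "('p, 'b, 'n) cat_scheme"
    and L :: "('o, 'a, 'p, 'b) fctr" and R :: "('p, 'b, 'o, 'a) fctr" +
  fixes \<eta> :: "'o \<Rightarrow> 'a" and \<epsilon> :: "'p \<Rightarrow> 'b"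
  assumes unit_in: "X \<in> Obj C \<Longrightarrow> \<eta> X \<in> hom C X (omap R (omap L X))"
    and unit_natural: "f \<in> hom C X X' \<Longrightarrow>
      \<eta> X' \<cdot>\<^bsub>C\<^esub> f = amap R (amap L f) \<cdot>\<^bsub>C\<^esub> \<eta> X"
    and counit_in: "Y \<in> Obj D \<Longrightarrow> \<epsilon> Y \<in> hom D (omap L (omap R Y)) Y"
    and counit_natural: "g \<in> hom D Y Y' \<Longrightarrow>
      \<epsilon> Y' \<cdot>\<^bsub>D\<^esub> amap L (amap R g) = g \<cdot>\<^bsub>D\<^esub> \<epsilon> Y"
    and triangle_left: "X \<in> Obj C \<Longrightarrow>
      \<epsilon> (omap L X) \<cdot>\<^bsub>D\<^esub> amap L (\<eta> X) = \<one>\<^bsub>D\<^esub> (omap L X)"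
    and triangle_right: "Y \<in> Obj D \<Longrightarrow>
      amap R (\<epsilon> Y) \<cdot>\<^bsub>C\<^esub> \<eta> (omap R Y) = \<one>\<^bsub>C\<^esub> (omap R Y)"

text \<open>The adjoint transpose \<open>L X \<rightarrow> Y\<close> of \<open>f : X \<rightarrow> R Y\<close>, where \<open>D\<close> is the codomain category
  of \<open>L\<close>.\<close>

definition transpose ::
  "('p, 'b, 'n) cat_scheme \<Rightarrow> ('o, 'a, 'p, 'b) fctr \<Rightarrow> ('p \<Rightarrow> 'b) \<Rightarrow> 'p \<Rightarrow> 'a \<Rightarrow> 'b" where
  "transpose D L \<epsilon> Y f = \<epsilon> Y \<cdot>\<^bsub>D\<^esub> amap L f"


section \<open>Left skew monoidal categories\<close>

record ('o, 'a) skew_monoidal = "('o, 'a) cat" +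
  tensor :: "('o \<times> 'o, 'a \<times> 'a, 'o, 'a) fctr"
  unit_ob :: 'o
  assoc :: "'o \<Rightarrow> 'o \<Rightarrow> 'o \<Rightarrow> 'a"
  lunit :: "'o \<Rightarrow> 'a"
  runit :: "'o \<Rightarrow> 'a"

text \<open>\<open>X \<otimes> Y\<close> is the tensor of objects, \<open>f \<boxtimes> g\<close> the tensor of arrows. The mathematical
  \<open>X \<otimes> f\<close> and \<open>f \<otimes> X\<close> are \<open>\<one> X \<boxtimes> f\<close> and \<open>f \<boxtimes> \<one> X\<close>.\<close>

abbreviation tensor_ob ::
  "('o, 'a, 'm) skew_monoidal_scheme \<Rightarrow> 'o \<Rightarrow> 'o \<Rightarrow> 'o"  (infixr "\<otimes>\<index>" 70) where
  "X \<otimes>\<^bsub>V\<^esub> Y \<equiv> omap (tensor V) (X, Y)"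

abbreviation tensor_arr ::
  "('o, 'a, 'm) skew_monoidal_scheme \<Rightarrow> 'a \<Rightarrow> 'a \<Rightarrow> 'a"  (infixr "\<boxtimes>\<index>" 70) where
  "f \<boxtimes>\<^bsub>V\<^esub> g \<equiv> amap (tensor V) (f, g)"

locale left_skew_monoidal = category V + tensor: is_functor "prod_cat V V" V "tensor V"
  for V :: "('o, 'a, 'm) skew_monoidal_scheme" (structure) +
  assumes unit_ob_in: "unit_ob V \<in> Obj V"
    and assoc_in: "A \<in> Obj V \<Longrightarrow> B \<in> Obj V \<Longrightarrow> C \<in> Obj V \<Longrightarrow>
      assoc V A B C \<in> hom V ((A \<otimes> B) \<otimes> C) (A \<otimes> (B \<otimes> C))"
    and assoc_natural: "f \<in> hom V A A' \<Longrightarrow> g \<in> hom V B B' \<Longrightarrow> h \<in> hom V C C' \<Longrightarrow>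
      assoc V A' B' C' \<cdot> ((f \<boxtimes> g) \<boxtimes> h) = (f \<boxtimes> (g \<boxtimes> h)) \<cdot> assoc V A B C"
    and lunit_in: "A \<in> Obj V \<Longrightarrow> lunit V A \<in> hom V (unit_ob V \<otimes> A) A"
    and lunit_natural: "f \<in> hom V A A' \<Longrightarrow>
      lunit V A' \<cdot> (\<one> (unit_ob V) \<boxtimes> f) = f \<cdot> lunit V A"
    and runit_in: "A \<in> Obj V \<Longrightarrow> runit V A \<in> hom V A (A \<otimes> unit_ob V)"
    and runit_natural: "f \<in> hom V A A' \<Longrightarrow>
      runit V A' \<cdot> f = (f \<boxtimes> \<one> (unit_ob V)) \<cdot> runit V A"
    and pentagon: "A \<in> Obj V \<Longrightarrow> B \<in> Obj V \<Longrightarrow> C \<in> Obj V \<Longrightarrow> D \<in> Obj V \<Longrightarrow>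
      (\<one> A \<boxtimes> assoc V B C D) \<cdot> assoc V A (B \<otimes> C) D \<cdot> (assoc V A B C \<boxtimes> \<one> D)
        = assoc V A B (C \<otimes> D) \<cdot> assoc V (A \<otimes> B) C D"
    and assoc_runit: "A \<in> Obj V \<Longrightarrow> B \<in> Obj V \<Longrightarrow>
      assoc V A B (unit_ob V) \<cdot> runit V (A \<otimes> B) = \<one> A \<boxtimes> runit V B"
    and lunit_assoc: "A \<in> Obj V \<Longrightarrow> B \<in> Obj V \<Longrightarrow>
      lunit V (A \<otimes> B) \<cdot> assoc V (unit_ob V) A B = lunit V A \<boxtimes> \<one> B"
    and lunit_runit: "lunit V (unit_ob V) \<cdot> runit V (unit_ob V) = \<one> (unit_ob V)"
    and triangle: "A \<in> Obj V \<Longrightarrow> B \<in> Obj V \<Longrightarrow>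
      (\<one> A \<boxtimes> lunit V B) \<cdot> assoc V A (unit_ob V) B \<cdot> (runit V A \<boxtimes> \<one> B) = \<one> (A \<otimes> B)"


section \<open>Strong left actions\<close>

text \<open>With \<open>X * A\<close> for the value of the action bifunctor at \<open>(X, A)\<close>, \<open>m X Y A\<close> is
  \<open>m\<^bsup>X,Y\<^esup>\<^bsub>A\<^esub> : (X \<otimes> Y) * A \<rightarrow> X * (Y * A)\<close>.\<close>

locale strong_left_action =
  V: left_skew_monoidal V + A: category A + act: is_functor "prod_cat V A" A act
  for V :: "('o, 'a, 'm) skew_monoidal_scheme" and A :: "('p, 'b, 'n) cat_scheme"
    and act :: "('o \<times> 'p, 'a \<times> 'b, 'p, 'b) fctr" +
  fixes m :: "'o \<Rightarrow> 'o \<Rightarrow> 'p \<Rightarrow> 'b" and u :: "'p \<Rightarrow> 'b"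
  assumes m_in: "X \<in> Obj V \<Longrightarrow> Y \<in> Obj V \<Longrightarrow> P \<in> Obj A \<Longrightarrow>
      m X Y P \<in> hom A (omap act (X \<otimes>\<^bsub>V\<^esub> Y, P)) (omap act (X, omap act (Y, P)))"
    and m_iso: "X \<in> Obj V \<Longrightarrow> Y \<in> Obj V \<Longrightarrow> P \<in> Obj A \<Longrightarrow> iso_arrow A (m X Y P)"
    and m_natural: "f \<in> hom V X X' \<Longrightarrow> g \<in> hom V Y Y' \<Longrightarrow> h \<in> hom A P P' \<Longrightarrow>
      m X' Y' P' \<cdot>\<^bsub>A\<^esub> amap act (f \<boxtimes>\<^bsub>V\<^esub> g, h)
        = amap act (f, amap act (g, h)) \<cdot>\<^bsub>A\<^esub> m X Y P"
    and u_in: "P \<in> Obj A \<Longrightarrow> u P \<in> hom A (omap act (unit_ob V, P)) P"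
    and u_iso: "P \<in> Obj A \<Longrightarrow> iso_arrow A (u P)"
    and u_natural: "h \<in> hom A P P' \<Longrightarrow>
      u P' \<cdot>\<^bsub>A\<^esub> amap act (\<one>\<^bsub>V\<^esub> (unit_ob V), h) = h \<cdot>\<^bsub>A\<^esub> u P"
    and act_assoc: "X \<in> Obj V \<Longrightarrow> Y \<in> Obj V \<Longrightarrow> Z \<in> Obj V \<Longrightarrow> P \<in> Obj A \<Longrightarrow>
      amap act (\<one>\<^bsub>V\<^esub> X, m Y Z P) \<cdot>\<^bsub>A\<^esub> m X (Y \<otimes>\<^bsub>V\<^esub> Z) P \<cdot>\<^bsub>A\<^esub> amap act (assoc V X Y Z, \<one>\<^bsub>A\<^esub> P)
        = m X Y (omap act (Z, P)) \<cdot>\<^bsub>A\<^esub> m (X \<otimes>\<^bsub>V\<^esub> Y) Z P"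
    and act_lunit: "X \<in> Obj V \<Longrightarrow> P \<in> Obj A \<Longrightarrow>
      u (omap act (X, P)) \<cdot>\<^bsub>A\<^esub> m (unit_ob V) X P = amap act (lunit V X, \<one>\<^bsub>A\<^esub> P)"
    and act_runit: "X \<in> Obj V \<Longrightarrow> P \<in> Obj A \<Longrightarrow>
      amap act (\<one>\<^bsub>V\<^esub> X, u P) \<cdot>\<^bsub>A\<^esub> m X (unit_ob V) P \<cdot>\<^bsub>A\<^esub> amap act (runit V X, \<one>\<^bsub>A\<^esub> P)
        = \<one>\<^bsub>A\<^esub> (omap act (X, P))"

text \<open>The functor \<open>J\<^sub>* : X \<mapsto> X * J\<close>.\<close>

definition act_on ::
  "('p, 'b, 'n) cat_scheme \<Rightarrow> ('o \<times> 'p, 'a \<times> 'b, 'p, 'b) fctr \<Rightarrow> 'p \<Rightarrow> ('o, 'a, 'p, 'b) fctr" where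
  "act_on A act J = \<lparr>omap = (\<lambda>X. omap act (X, J)), amap = (\<lambda>f. amap act (f, \<one>\<^bsub>A\<^esub> J))\<rparr>"


section \<open>The induced skew monoidal structure\<close>

text \<open>Here \<open>L\<close> is \<open>J\<^sub>!\<close>. The arrow \<open>\<gamma>\<close>-tilde is the transpose
  \<open>J\<^sub>!(J\<^sub>!P * Q) \<rightarrow> J\<^sub>!P \<otimes> J\<^sub>!Q\<close>.\<close>

definition gamma_tilde ::
  "('o, 'a, 'm) skew_monoidal_scheme \<Rightarrow> ('p, 'b, 'n) cat_scheme \<Rightarrow>
   ('o \<times> 'p, 'a \<times> 'b, 'p, 'b) fctr \<Rightarrow> ('o \<Rightarrow> 'o \<Rightarrow> 'p \<Rightarrow> 'b) \<Rightarrow> 'p \<Rightarrow>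
   ('p, 'b, 'o, 'a) fctr \<Rightarrow> ('p \<Rightarrow> 'b) \<Rightarrow> ('o \<Rightarrow> 'a) \<Rightarrow> 'p \<Rightarrow> 'p \<Rightarrow> 'a" where
  "gamma_tilde V A act m J L \<eta> \<epsilon> P Q =
    transpose V L \<epsilon> (omap L P \<otimes>\<^bsub>V\<^esub> omap L Q)
      (inv_arrow A (m (omap L P) (omap L Q) J) \<cdot>\<^bsub>A\<^esub> amap act (\<one>\<^bsub>V\<^esub> (omap L P), \<eta> Q))"

definition induced_skew_monoidal ::
  "('o, 'a, 'm) skew_monoidal_scheme \<Rightarrow> ('p, 'b, 'n) cat_scheme \<Rightarrow>
   ('o \<times> 'p, 'a \<times> 'b, 'p, 'b) fctr \<Rightarrow> ('o \<Rightarrow> 'o \<Rightarrow> 'p \<Rightarrow> 'b) \<Rightarrow> ('p \<Rightarrow> 'b) \<Rightarrow> 'p \<Rightarrow>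
   ('p, 'b, 'o, 'a) fctr \<Rightarrow> ('p \<Rightarrow> 'b) \<Rightarrow> ('o \<Rightarrow> 'a) \<Rightarrow> ('p, 'b) skew_monoidal" where
  "induced_skew_monoidal V A act m u J L \<eta> \<epsilon> =
    \<lparr>Obj = Obj A, Arr = Arr A, Dom = Dom A, Cod = Cod A, Ident = Ident A, Comp = Comp A,
     tensor = \<lparr>omap = (\<lambda>(P, Q). omap act (omap L P, Q)),
               amap = (\<lambda>(f, g). amap act (amap L f, g))\<rparr>,
     unit_ob = J,
     assoc = (\<lambda>P Q R. m (omap L P) (omap L Q) R \<cdot>\<^bsub>A\<^esub>
               amap act (gamma_tilde V A act m J L \<eta> \<epsilon> P Q, \<one>\<^bsub>A\<^esub> R)),
     lunit = (\<lambda>P. u P \<cdot>\<^bsub>A\<^esub> amap act (\<epsilon> (unit_ob V), \<one>\<^bsub>A\<^esub> P) \<cdot>\<^bsub>A\<^esub>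
               amap act (amap L (inv_arrow A (u J)), \<one>\<^bsub>A\<^esub> P)),
     runit = \<eta>\<rparr>"


section \<open>Lax and oplax monoidal structures, and mates\<close>

locale lax_monoidal =
  V: left_skew_monoidal V + A: left_skew_monoidal A + F: is_functor V A F
  for V :: "('o, 'a, 'm) skew_monoidal_scheme" and A :: "('p, 'b, 'n) skew_monoidal_scheme"
    and F :: "('o, 'a, 'p, 'b) fctr" +
  fixes \<phi> :: "'o \<Rightarrow> 'o \<Rightarrow> 'b" and \<iota> :: "'b"
  assumes \<phi>_in: "X \<in> Obj V \<Longrightarrow> Y \<in> Obj V \<Longrightarrow>
      \<phi> X Y \<in> hom A (omap F X \<otimes>\<^bsub>A\<^esub> omap F Y) (omap F (X \<otimes>\<^bsub>V\<^esub> Y))"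
    and \<phi>_natural: "f \<in> hom V X X' \<Longrightarrow> g \<in> hom V Y Y' \<Longrightarrow>
      \<phi> X' Y' \<cdot>\<^bsub>A\<^esub> (amap F f \<boxtimes>\<^bsub>A\<^esub> amap F g) = amap F (f \<boxtimes>\<^bsub>V\<^esub> g) \<cdot>\<^bsub>A\<^esub> \<phi> X Y"
    and \<iota>_in: "\<iota> \<in> hom A (unit_ob A) (omap F (unit_ob V))"
    and lax_assoc: "X \<in> Obj V \<Longrightarrow> Y \<in> Obj V \<Longrightarrow> Z \<in> Obj V \<Longrightarrow>
      \<phi> X (Y \<otimes>\<^bsub>V\<^esub> Z) \<cdot>\<^bsub>A\<^esub> (\<one>\<^bsub>A\<^esub> (omap F X) \<boxtimes>\<^bsub>A\<^esub> \<phi> Y Z)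
          \<cdot>\<^bsub>A\<^esub> assoc A (omap F X) (omap F Y) (omap F Z)
        = amap F (assoc V X Y Z) \<cdot>\<^bsub>A\<^esub> \<phi> (X \<otimes>\<^bsub>V\<^esub> Y) Z \<cdot>\<^bsub>A\<^esub> (\<phi> X Y \<boxtimes>\<^bsub>A\<^esub> \<one>\<^bsub>A\<^esub> (omap F Z))"
    and lax_lunit: "X \<in> Obj V \<Longrightarrow>
      amap F (lunit V X) \<cdot>\<^bsub>A\<^esub> \<phi> (unit_ob V) X \<cdot>\<^bsub>A\<^esub> (\<iota> \<boxtimes>\<^bsub>A\<^esub> \<one>\<^bsub>A\<^esub> (omap F X))
        = lunit A (omap F X)"
    and lax_runit: "X \<in> Obj V \<Longrightarrow>
      \<phi> X (unit_ob V) \<cdot>\<^bsub>A\<^esub> (\<one>\<^bsub>A\<^esub> (omap F X) \<boxtimes>\<^bsub>A\<^esub> \<iota>) \<cdot>\<^bsub>A\<^esub> runit A (omap F X)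
        = amap F (runit V X)"

locale oplax_monoidal =
  A: left_skew_monoidal A + V: left_skew_monoidal V + G: is_functor A V G
  for A :: "('p, 'b, 'n) skew_monoidal_scheme" and V :: "('o, 'a, 'm) skew_monoidal_scheme"
    and G :: "('p, 'b, 'o, 'a) fctr" +
  fixes \<psi> :: "'p \<Rightarrow> 'p \<Rightarrow> 'a" and \<psi>\<^sub>0 :: "'a"
  assumes \<psi>_in: "P \<in> Obj A \<Longrightarrow> Q \<in> Obj A \<Longrightarrow>
      \<psi> P Q \<in> hom V (omap G (P \<otimes>\<^bsub>A\<^esub> Q)) (omap G P \<otimes>\<^bsub>V\<^esub> omap G Q)"
    and \<psi>_natural: "f \<in> hom A P P' \<Longrightarrow> g \<in> hom A Q Q' \<Longrightarrow>
      \<psi> P' Q' \<cdot>\<^bsub>V\<^esub> amap G (f \<boxtimes>\<^bsub>A\<^esub> g) = (amap G f \<boxtimes>\<^bsub>V\<^esub> amap G g) \<cdot>\<^bsub>V\<^esub> \<psi> P Q"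
    and \<psi>\<^sub>0_in: "\<psi>\<^sub>0 \<in> hom V (omap G (unit_ob A)) (unit_ob V)"
    and oplax_assoc: "P \<in> Obj A \<Longrightarrow> Q \<in> Obj A \<Longrightarrow> R \<in> Obj A \<Longrightarrow>
      (\<one>\<^bsub>V\<^esub> (omap G P) \<boxtimes>\<^bsub>V\<^esub> \<psi> Q R) \<cdot>\<^bsub>V\<^esub> \<psi> P (Q \<otimes>\<^bsub>A\<^esub> R) \<cdot>\<^bsub>V\<^esub> amap G (assoc A P Q R)
        = assoc V (omap G P) (omap G Q) (omap G R) \<cdot>\<^bsub>V\<^esub>
          (\<psi> P Q \<boxtimes>\<^bsub>V\<^esub> \<one>\<^bsub>V\<^esub> (omap G R)) \<cdot>\<^bsub>V\<^esub> \<psi> (P \<otimes>\<^bsub>A\<^esub> Q) R"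
    and oplax_lunit: "P \<in> Obj A \<Longrightarrow>
      lunit V (omap G P) \<cdot>\<^bsub>V\<^esub> (\<psi>\<^sub>0 \<boxtimes>\<^bsub>V\<^esub> \<one>\<^bsub>V\<^esub> (omap G P)) \<cdot>\<^bsub>V\<^esub> \<psi> (unit_ob A) P
        = amap G (lunit A P)"
    and oplax_runit: "P \<in> Obj A \<Longrightarrow>
      (\<one>\<^bsub>V\<^esub> (omap G P) \<boxtimes>\<^bsub>V\<^esub> \<psi>\<^sub>0) \<cdot>\<^bsub>V\<^esub> \<psi> P (unit_ob A) \<cdot>\<^bsub>V\<^esub> amap G (runit A P)
        = runit V (omap G P)"

text \<open>\<open>G : A \<rightarrow> V\<close> is the left adjoint, with unit \<open>\<eta>\<close> and counit \<open>\<epsilon>\<close>.\<close>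

definition mates ::
  "('p, 'b, 'n) skew_monoidal_scheme \<Rightarrow> ('o, 'a, 'm) skew_monoidal_scheme \<Rightarrow>
   ('p, 'b, 'o, 'a) fctr \<Rightarrow> ('p \<Rightarrow> 'b) \<Rightarrow> ('o \<Rightarrow> 'a) \<Rightarrow>
   ('o \<Rightarrow> 'o \<Rightarrow> 'b) \<Rightarrow> 'b \<Rightarrow> ('p \<Rightarrow> 'p \<Rightarrow> 'a) \<Rightarrow> 'a \<Rightarrow> bool" where
  "mates A V G \<eta> \<epsilon> \<phi> \<iota> \<psi> \<psi>\<^sub>0 \<longleftrightarrow>
    (\<forall>P\<in>Obj A. \<forall>Q\<in>Obj A.
      \<psi> P Q = transpose V G \<epsilon> (omap G P \<otimes>\<^bsub>V\<^esub> omap G Q)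
                (\<phi> (omap G P) (omap G Q) \<cdot>\<^bsub>A\<^esub> (\<eta> P \<boxtimes>\<^bsub>A\<^esub> \<eta> Q))) \<and>
    \<psi>\<^sub>0 = transpose V G \<epsilon> (unit_ob V) \<iota>"

end

theory Submission
  imports Defs
begin

text \<open>Write \<open>X * P\<close> for the action, \<open>P \<lhd> Q = L P * Q\<close> for the induced tensor, and \<open>L\<close> for the left
  adjoint \<open>J\<^sub>!\<close> of \<open>X \<mapsto> X * J\<close>. Take for \<open>\<iota>\<close> the inverse of \<open>u J\<close> and for \<open>\<phi> X Y\<close> the inverse of \<open>m\<close>
  after \<open>\<epsilon> X * (Y * J)\<close>. By a triangle identity their mates are
  \<open>\<psi> P Q = gamma_tilde P Q\<close> and \<open>\<psi>\<^sub>0 = \<epsilon> I \<cdot> L \<iota>\<close>. In these terms the induced constraints are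
  \<open>\<gamma> P Q R = m \<cdot> (\<psi> P Q * R)\<close>, \<open>\<lambda> P = u P \<cdot> (\<psi>\<^sub>0 * P)\<close> and \<open>\<rho> = \<eta>\<close>.

  Everything is driven by the two equations that characterise \<open>\<psi>\<close> and \<open>\<psi>\<^sub>0\<close>,
  \<open>m \<cdot> (\<psi> P Q * J) \<cdot> \<eta> = L P * \<eta> Q\<close> and \<open>u J \<cdot> (\<psi>\<^sub>0 * J) \<cdot> \<eta> J = 1\<close> (lemmas \<open>psi_flat\<close> and \<open>psi0_flat\<close>).
  An equation between arrows out of \<open>L P\<close> may be tested after applying \<open>- * J\<close> and composing with
  \<open>\<eta> P\<close>; if the target is a tensor product one may further compose with the invertible \<open>m\<close>
  (lemmas \<open>flat_inject\<close> and \<open>flat_m_inject\<close>). Tested in this way, the oplax axioms for \<open>\<psi>\<close>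
  (lemmas \<open>psi_assoc\<close>, \<open>psi_lunit\<close>, \<open>psi_runit\<close>) follow from the three action axioms, naturality, and the
  two equations above.

  The skew monoidal axioms for \<open>\<lhd>\<close> come next, since the oplax axioms are what they rest on: acting on
  an object \<open>S\<close> with the oplax associativity axiom and composing with \<open>m\<close> gives the pentagon, and the
  two oplax unit axioms give in the same way the axiom relating \<open>\<lambda>\<close> to \<open>\<gamma>\<close> and the triangle. The
  remaining two axioms, \<open>\<gamma> P Q J \<cdot> \<rho> = P \<lhd> \<rho> Q\<close> and \<open>\<lambda> J \<cdot> \<rho> J = 1\<close>, are the
  characterising equations themselves.

  For the lax structure, the unit axioms are computed directly, and associativity reduces after
  cancelling the isomorphisms \<open>m\<close> to the compatibility of \<open>\<epsilon>\<close> with \<open>\<phi>\<close> and \<open>\<psi>\<close>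
  (lemma \<open>counit_psi\<close>), again tested by transposing.\<close>

section \<open>Arrow calculus in a category\<close>

lemma hom_iff: "f \<in> hom C X Y \<longleftrightarrow> f \<in> Arr C \<and> Dom C f = X \<and> Cod C f = Y"
  by (simp add: hom_def)

text \<open>The axioms of a category are restated with explicit domains and codomains. The simplifier can then
  check composability by computing them, with no intermediate object to guess, and it brings
  composites into right-associated form.\<close>

context category
begin

lemma Comp_typing [simp]:
  assumes "f \<in> Arr C" "g \<in> Arr C" "Dom C g = Cod C f"
  shows "g \<cdot> f \<in> Arr C" "Dom C (g \<cdot> f) = Dom C f" "Cod C (g \<cdot> f) = Cod C g"
  using Comp_in[of f "Dom C f" "Cod C f" g "Cod C g"] assms by (simp_all add: hom_iff)

lemma Ident_typing [simp]:
  assumes "X \<in> Obj C"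
  shows "\<one> X \<in> Arr C" "Dom C (\<one> X) = X" "Cod C (\<one> X) = X"
  using Ident_in[OF assms] by (simp_all add: hom_iff)

lemma Comp_Ident [simp]:
  assumes "f \<in> Arr C"
  shows "Cod C f = Y \<Longrightarrow> \<one> Y \<cdot> f = f" "Dom C f = X \<Longrightarrow> f \<cdot> \<one> X = f"
  using assms Ident_left Ident_right by (auto simp: hom_iff)

lemma Comp_assoc_right [simp]:
  assumes "f \<in> Arr C" "g \<in> Arr C" "h \<in> Arr C" "Dom C g = Cod C f" "Dom C h = Cod C g"
  shows "(h \<cdot> g) \<cdot> f = h \<cdot> g \<cdot> f"
  using assms Comp_assoc by (auto simp: hom_iff)

text \<open>In a right-associated composite an equation \<open>g \<cdot> f = k\<close> no longer applies to a \<open>g \<cdot> f\<close> that is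
  followed by further arrows. This rule and the next turn an equation into the version that does.\<close>

lemma Comp_reduce:
  assumes "g \<cdot> f = k" "f \<in> Arr C" "g \<in> Arr C" "x \<in> Arr C" "Dom C g = Cod C f" "Dom C f = Cod C x"
  shows "g \<cdot> f \<cdot> x = k \<cdot> x"
  using assms Comp_assoc_right[of x f g] by simp

lemma Comp_reduce3:
  assumes "h \<cdot> g \<cdot> f = k" "f \<in> Arr C" "g \<in> Arr C" "h \<in> Arr C" "x \<in> Arr C"
    "Dom C h = Cod C g" "Dom C g = Cod C f" "Dom C f = Cod C x"
  shows "h \<cdot> g \<cdot> f \<cdot> x = k \<cdot> x"
  using assms Comp_assoc_right[of x "g \<cdot> f" h] by simp

lemma inverse_arrows_inv_arrow:
  assumes "iso_arrow C f"
  shows "inverse_arrows C f (inv_arrow C f)"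
proof -
  obtain g where g: "inverse_arrows C f g" using assms by (auto simp: iso_arrow_def)
  have "h = g" if h: "inverse_arrows C f h" for h
  proof -
    have "h = h \<cdot> f \<cdot> g" using g h by (simp add: inverse_arrows_def hom_iff)
    also have "\<dots> = (h \<cdot> f) \<cdot> g" using g h by (subst Comp_assoc_right) (auto simp: inverse_arrows_def hom_iff)
    also have "\<dots> = g" using g h by (simp add: inverse_arrows_def hom_iff)
    finally show ?thesis .
  qed
  then show ?thesis unfolding inv_arrow_def using g by (rule theI[rotated])
qed

lemma inv_arrow_simps:
  assumes "iso_arrow C f"
  shows "inv_arrow C f \<in> Arr C" "Dom C (inv_arrow C f) = Cod C f" "Cod C (inv_arrow C f) = Dom C f"
    "inv_arrow C f \<cdot> f = \<one> (Dom C f)" "f \<cdot> inv_arrow C f = \<one> (Cod C f)"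
  using inverse_arrows_inv_arrow[OF assms] by (auto simp: inverse_arrows_def hom_iff)

lemma iso_arrow_cancel_left:
  assumes "iso_arrow C f" "f \<cdot> x = f \<cdot> y"
    "x \<in> Arr C" "y \<in> Arr C" "Cod C x = Dom C f" "Cod C y = Dom C f"
  shows "x = y"
proof -
  have f: "f \<in> Arr C" using assms(1) by (auto simp: iso_arrow_def inverse_arrows_def)
  note i = inv_arrow_simps[OF assms(1)]
  have "inv_arrow C f \<cdot> f \<cdot> z = z" if "z \<in> Arr C" "Cod C z = Dom C f" for z
    using Comp_reduce[OF i(4), of z] that f i by simp
  from this[of x] this[of y] show ?thesis using assms(2-6) by metis
qed

end

section \<open>Functors and whiskering\<close>

lemma prod_cat_simps [simp]:
  "Obj (prod_cat C D) = Obj C \<times> Obj D"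
  "Arr (prod_cat C D) = Arr C \<times> Arr D"
  "Dom (prod_cat C D) (f, g) = (Dom C f, Dom D g)"
  "Cod (prod_cat C D) (f, g) = (Cod C f, Cod D g)"
  "\<one>\<^bsub>prod_cat C D\<^esub> (X, Y) = (\<one>\<^bsub>C\<^esub> X, \<one>\<^bsub>D\<^esub> Y)"
  "(f', g') \<cdot>\<^bsub>prod_cat C D\<^esub> (f, g) = (f' \<cdot>\<^bsub>C\<^esub> f, g' \<cdot>\<^bsub>D\<^esub> g)"
  by (simp_all add: prod_cat_def)

lemma (in is_functor) amap_typing [simp]:
  assumes "f \<in> Arr C"
  shows "amap F f \<in> Arr D" "Dom D (amap F f) = omap F (Dom C f)" "Cod D (amap F f) = omap F (Cod C f)"
  using amap_in[of f "Dom C f" "Cod C f"] assms by (simp_all add: hom_iff)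

lemma (in is_functor) amap_Comp_Arr:
  assumes "f \<in> Arr C" "g \<in> Arr C" "Dom C g = Cod C f"
  shows "amap F (g \<cdot>\<^bsub>C\<^esub> f) = amap F g \<cdot>\<^bsub>D\<^esub> amap F f"
  using amap_Comp[of f "Dom C f" "Cod C f" g "Cod C g"] assms by (simp add: hom_iff)

lemma act_on_simps [simp]:
  "omap (act_on A act J) X = omap act (X, J)"
  "amap (act_on A act J) f = amap act (f, \<one>\<^bsub>A\<^esub> J)"
  by (simp_all add: act_on_def)

text \<open>A bifunctor distributes over composites when the other argument is an identity. With these rules
  as rewrite rules the normal form of an arrow is a composite of arrows whiskered on one side,
  and \<open>interchange\<close> swaps two adjacent whiskerings on different sides.\<close>

locale bifunctor = C1: category C + C2: category D + is_functor "prod_cat C D" E F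
  for C :: "('o, 'a, 'm) cat_scheme" and D :: "('p, 'b, 'n) cat_scheme"
    and E :: "('q, 'c, 'k) cat_scheme" and F
begin

lemma bi_Ident [simp]: "X \<in> Obj C \<Longrightarrow> Y \<in> Obj D \<Longrightarrow>
    amap F (\<one>\<^bsub>C\<^esub> X, \<one>\<^bsub>D\<^esub> Y) = \<one>\<^bsub>E\<^esub> (omap F (X, Y))"
  using amap_Ident[of "(X, Y)"] by simp

lemma bi_Comp:
  assumes "f \<in> Arr C" "f' \<in> Arr C" "g \<in> Arr D" "g' \<in> Arr D" "Dom C f' = Cod C f" "Dom D g' = Cod D g"
  shows "amap F (f', g') \<cdot>\<^bsub>E\<^esub> amap F (f, g) = amap F (f' \<cdot>\<^bsub>C\<^esub> f, g' \<cdot>\<^bsub>D\<^esub> g)"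
  using amap_Comp_Arr[of "(f, g)" "(f', g')"] assms by simp

lemma whisker_Comp [simp]:
  shows "f \<in> Arr C \<Longrightarrow> f' \<in> Arr C \<Longrightarrow> Dom C f' = Cod C f \<Longrightarrow> Y \<in> Obj D \<Longrightarrow>
      amap F (f' \<cdot>\<^bsub>C\<^esub> f, \<one>\<^bsub>D\<^esub> Y) = amap F (f', \<one>\<^bsub>D\<^esub> Y) \<cdot>\<^bsub>E\<^esub> amap F (f, \<one>\<^bsub>D\<^esub> Y)"
    and "g \<in> Arr D \<Longrightarrow> g' \<in> Arr D \<Longrightarrow> Dom D g' = Cod D g \<Longrightarrow> X \<in> Obj C \<Longrightarrow>
      amap F (\<one>\<^bsub>C\<^esub> X, g' \<cdot>\<^bsub>D\<^esub> g) = amap F (\<one>\<^bsub>C\<^esub> X, g') \<cdot>\<^bsub>E\<^esub> amap F (\<one>\<^bsub>C\<^esub> X, g)"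
  by (simp_all add: bi_Comp)

lemma interchange:
  assumes "f \<in> Arr C" "g \<in> Arr D" "Dom C f = X" "Cod C f = X'" "Dom D g = Y" "Cod D g = Y'"
  shows "amap F (f, \<one>\<^bsub>D\<^esub> Y') \<cdot>\<^bsub>E\<^esub> amap F (\<one>\<^bsub>C\<^esub> X, g) = amap F (\<one>\<^bsub>C\<^esub> X', g) \<cdot>\<^bsub>E\<^esub> amap F (f, \<one>\<^bsub>D\<^esub> Y)"
  using assms by (auto simp: bi_Comp)

lemma decompose:
  assumes "f \<in> Arr C" "g \<in> Arr D"
  shows "amap F (f, g) = amap F (\<one>\<^bsub>C\<^esub> (Cod C f), g) \<cdot>\<^bsub>E\<^esub> amap F (f, \<one>\<^bsub>D\<^esub> (Dom D g))"
  using assms by (auto simp: bi_Comp)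

end

section \<open>Transposition along the adjunction\<close>

locale action_with_adjoint =
  strong_left_action V A act m u +
  adj: adjunction A V L "act_on A act J" \<eta> \<epsilon>
  for V :: "('o, 'a, 'm) skew_monoidal_scheme" and A :: "('p, 'b, 'n) cat_scheme"
    and act :: "('o \<times> 'p, 'a \<times> 'b, 'p, 'b) fctr"
    and m :: "'o \<Rightarrow> 'o \<Rightarrow> 'p \<Rightarrow> 'b" and u :: "'p \<Rightarrow> 'b"
    and J :: 'p and L :: "('p, 'b, 'o, 'a) fctr" and \<eta> :: "'p \<Rightarrow> 'b" and \<epsilon> :: "'o \<Rightarrow> 'a" +
  assumes J_in [simp]: "J \<in> Obj A"
begin

sublocale act: bifunctor V A A act by unfold_locales
sublocale tensor: bifunctor V V V "tensor V" by unfold_locales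

abbreviation act_ob (infixr "\<odot>" 70) where "X \<odot> P \<equiv> omap act (X, P)"
abbreviation act_arr (infixr "\<star>" 70) where "f \<star> g \<equiv> amap act (f, g)"
abbreviation I where "I \<equiv> unit_ob V"
abbreviation \<psi> where "\<psi> P Q \<equiv> gamma_tilde V A act m J L \<eta> \<epsilon> P Q"
abbreviation \<psi>\<^sub>0 where "\<psi>\<^sub>0 \<equiv> transpose V L \<epsilon> I (inv_arrow A (u J))"

lemmas [simp] = adj.L.omap_in V.tensor.omap_in act.omap_in V.unit_ob_in adj.L.amap_Comp_Arr adj.L.amap_Ident

lemma structure_typing [simp]:
  shows "X \<in> Obj V \<Longrightarrow> Y \<in> Obj V \<Longrightarrow> P \<in> Obj A \<Longrightarrow> m X Y P \<in> Arr A"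
    "X \<in> Obj V \<Longrightarrow> Y \<in> Obj V \<Longrightarrow> P \<in> Obj A \<Longrightarrow> Dom A (m X Y P) = (X \<otimes>\<^bsub>V\<^esub> Y) \<odot> P"
    "X \<in> Obj V \<Longrightarrow> Y \<in> Obj V \<Longrightarrow> P \<in> Obj A \<Longrightarrow> Cod A (m X Y P) = X \<odot> Y \<odot> P"
    "P \<in> Obj A \<Longrightarrow> u P \<in> Arr A"
    "P \<in> Obj A \<Longrightarrow> Dom A (u P) = I \<odot> P"
    "P \<in> Obj A \<Longrightarrow> Cod A (u P) = P"
    "P \<in> Obj A \<Longrightarrow> \<eta> P \<in> Arr A"
    "P \<in> Obj A \<Longrightarrow> Dom A (\<eta> P) = P"
    "P \<in> Obj A \<Longrightarrow> Cod A (\<eta> P) = omap L P \<odot> J"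
    "X \<in> Obj V \<Longrightarrow> \<epsilon> X \<in> Arr V"
    "X \<in> Obj V \<Longrightarrow> Dom V (\<epsilon> X) = omap L (X \<odot> J)"
    "X \<in> Obj V \<Longrightarrow> Cod V (\<epsilon> X) = X"
    "X \<in> Obj V \<Longrightarrow> Y \<in> Obj V \<Longrightarrow> Z \<in> Obj V \<Longrightarrow> assoc V X Y Z \<in> Arr V"
    "X \<in> Obj V \<Longrightarrow> Y \<in> Obj V \<Longrightarrow> Z \<in> Obj V \<Longrightarrow> Dom V (assoc V X Y Z) = (X \<otimes>\<^bsub>V\<^esub> Y) \<otimes>\<^bsub>V\<^esub> Z"
    "X \<in> Obj V \<Longrightarrow> Y \<in> Obj V \<Longrightarrow> Z \<in> Obj V \<Longrightarrow> Cod V (assoc V X Y Z) = X \<otimes>\<^bsub>V\<^esub> Y \<otimes>\<^bsub>V\<^esub> Z"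
    "X \<in> Obj V \<Longrightarrow> lunit V X \<in> Arr V"
    "X \<in> Obj V \<Longrightarrow> Dom V (lunit V X) = I \<otimes>\<^bsub>V\<^esub> X"
    "X \<in> Obj V \<Longrightarrow> Cod V (lunit V X) = X"
    "X \<in> Obj V \<Longrightarrow> runit V X \<in> Arr V"
    "X \<in> Obj V \<Longrightarrow> Dom V (runit V X) = X"
    "X \<in> Obj V \<Longrightarrow> Cod V (runit V X) = X \<otimes>\<^bsub>V\<^esub> I"
  using m_in u_in adj.unit_in adj.counit_in V.assoc_in V.lunit_in V.runit_in
  by (simp_all add: hom_iff)

lemma inv_m [simp]:
  assumes "X \<in> Obj V" "Y \<in> Obj V" "P \<in> Obj A"
  shows "inv_arrow A (m X Y P) \<in> Arr A"
    "Dom A (inv_arrow A (m X Y P)) = X \<odot> Y \<odot> P"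
    "Cod A (inv_arrow A (m X Y P)) = (X \<otimes>\<^bsub>V\<^esub> Y) \<odot> P"
    "m X Y P \<cdot>\<^bsub>A\<^esub> inv_arrow A (m X Y P) = \<one>\<^bsub>A\<^esub> (X \<odot> Y \<odot> P)"
  using A.inv_arrow_simps[OF m_iso[OF assms]] assms by simp_all

lemma inv_m_reduce [simp]:
  assumes "X \<in> Obj V" "Y \<in> Obj V" "P \<in> Obj A" "x \<in> Arr A" "Cod A x = X \<odot> Y \<odot> P"
  shows "m X Y P \<cdot>\<^bsub>A\<^esub> inv_arrow A (m X Y P) \<cdot>\<^bsub>A\<^esub> x = x"
  using A.Comp_reduce[OF inv_m(4)] assms by simp

lemma inv_u [simp]:
  assumes "P \<in> Obj A"
  shows "inv_arrow A (u P) \<in> Arr A"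
    "Dom A (inv_arrow A (u P)) = P"
    "Cod A (inv_arrow A (u P)) = I \<odot> P"
    "u P \<cdot>\<^bsub>A\<^esub> inv_arrow A (u P) = \<one>\<^bsub>A\<^esub> P"
  using A.inv_arrow_simps[OF u_iso[OF assms]] assms by simp_all

lemma m_cancel:
  assumes "m X Y P \<cdot>\<^bsub>A\<^esub> f = m X Y P \<cdot>\<^bsub>A\<^esub> g"
    "X \<in> Obj V" "Y \<in> Obj V" "P \<in> Obj A" "f \<in> Arr A" "g \<in> Arr A"
    "Cod A f = (X \<otimes>\<^bsub>V\<^esub> Y) \<odot> P" "Cod A g = (X \<otimes>\<^bsub>V\<^esub> Y) \<odot> P"
  shows "f = g"
  using A.iso_arrow_cancel_left[OF m_iso assms(1)] assms by simp

text \<open>With this, \<open>X * m\<close> and \<open>X * u\<close> can be cancelled, as needed to compare both sides of an equation after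
  bringing it into the shape of an action axiom.\<close>

lemma whisker_iso:
  assumes "iso_arrow A f" "X \<in> Obj V"
  shows "iso_arrow A (\<one>\<^bsub>V\<^esub> X \<star> f)"
proof -
  have f: "f \<in> Arr A" using assms(1) by (auto simp: iso_arrow_def inverse_arrows_def)
  note i = A.inv_arrow_simps[OF assms(1)]
  have "inverse_arrows A (\<one>\<^bsub>V\<^esub> X \<star> f) (\<one>\<^bsub>V\<^esub> X \<star> inv_arrow A f)"
    unfolding inverse_arrows_def using f i assms(2)
    by (simp add: hom_iff flip: act.whisker_Comp)
  then show ?thesis by (auto simp: iso_arrow_def)
qed

text \<open>Naturality of \<open>m\<close> in one argument at a time, with the identities that whiskering in two arguments
  produces already merged into one, so that the rules match arrows in normal form.\<close>

lemma m_whisker: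
  shows "f \<in> Arr V \<Longrightarrow> Cod V f = X' \<Longrightarrow> Y \<in> Obj V \<Longrightarrow> P \<in> Obj A \<Longrightarrow>
      m X' Y P \<cdot>\<^bsub>A\<^esub> ((f \<boxtimes>\<^bsub>V\<^esub> \<one>\<^bsub>V\<^esub> Y) \<star> \<one>\<^bsub>A\<^esub> P) = (f \<star> \<one>\<^bsub>A\<^esub> (Y \<odot> P)) \<cdot>\<^bsub>A\<^esub> m (Dom V f) Y P"
    and "g \<in> Arr V \<Longrightarrow> Cod V g = Y' \<Longrightarrow> X \<in> Obj V \<Longrightarrow> P \<in> Obj A \<Longrightarrow>
      m X Y' P \<cdot>\<^bsub>A\<^esub> ((\<one>\<^bsub>V\<^esub> X \<boxtimes>\<^bsub>V\<^esub> g) \<star> \<one>\<^bsub>A\<^esub> P) = (\<one>\<^bsub>V\<^esub> X \<star> g \<star> \<one>\<^bsub>A\<^esub> P) \<cdot>\<^bsub>A\<^esub> m X (Dom V g) P"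
    and "h \<in> Arr A \<Longrightarrow> Cod A h = P' \<Longrightarrow> X \<in> Obj V \<Longrightarrow> Y \<in> Obj V \<Longrightarrow>
      m X Y P' \<cdot>\<^bsub>A\<^esub> (\<one>\<^bsub>V\<^esub> (X \<otimes>\<^bsub>V\<^esub> Y) \<star> h) = (\<one>\<^bsub>V\<^esub> X \<star> \<one>\<^bsub>V\<^esub> Y \<star> h) \<cdot>\<^bsub>A\<^esub> m X Y (Dom A h)"
  using m_natural[of f "Dom V f" X' "\<one>\<^bsub>V\<^esub> Y" Y Y "\<one>\<^bsub>A\<^esub> P" P P]
    m_natural[of "\<one>\<^bsub>V\<^esub> X" X X g "Dom V g" Y' "\<one>\<^bsub>A\<^esub> P" P P]
    m_natural[of "\<one>\<^bsub>V\<^esub> X" X X "\<one>\<^bsub>V\<^esub> Y" Y Y h "Dom A h" P']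
  by (auto simp: hom_iff)

lemma unit_nat:
  assumes "f \<in> Arr A" "Dom A f = P"
  shows "(amap L f \<star> \<one>\<^bsub>A\<^esub> J) \<cdot>\<^bsub>A\<^esub> \<eta> P = \<eta> (Cod A f) \<cdot>\<^bsub>A\<^esub> f"
  using adj.unit_natural[of f P "Cod A f"] assms by (simp add: hom_iff)

text \<open>The transpose of \<open>k : L P \<rightarrow> X\<close> in the other direction is \<open>(k * J) \<cdot> \<eta> P : P \<rightarrow> X * J\<close>, called the flat
  of \<open>k\<close> below. It is a left inverse of \<open>transpose\<close> by one triangle identity, and injective by the other.\<close>

lemma flat_transpose:
  assumes "f \<in> Arr A" "Dom A f = P" "Cod A f = X \<odot> J" "X \<in> Obj V"
  shows "(transpose V L \<epsilon> X f \<star> \<one>\<^bsub>A\<^esub> J) \<cdot>\<^bsub>A\<^esub> \<eta> P = f"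
proof -
  have P: "P \<in> Obj A" using assms by auto
  have "(transpose V L \<epsilon> X f \<star> \<one>\<^bsub>A\<^esub> J) \<cdot>\<^bsub>A\<^esub> \<eta> P
      = (\<epsilon> X \<star> \<one>\<^bsub>A\<^esub> J) \<cdot>\<^bsub>A\<^esub> \<eta> (X \<odot> J) \<cdot>\<^bsub>A\<^esub> f"
    using assms P by (simp add: transpose_def unit_nat)
  also have "\<dots> = f"
    using A.Comp_reduce[OF adj.triangle_right[of X, simplified], of f] assms by simp
  finally show ?thesis .
qed

lemma flat_inject:
  assumes "(f \<star> \<one>\<^bsub>A\<^esub> J) \<cdot>\<^bsub>A\<^esub> \<eta> P = (g \<star> \<one>\<^bsub>A\<^esub> J) \<cdot>\<^bsub>A\<^esub> \<eta> P"
    "P \<in> Obj A" "f \<in> Arr V" "g \<in> Arr V" "Dom V f = omap L P" "Dom V g = omap L P" "Cod V f = Cod V g"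
  shows "f = g"
proof -
  have *: "transpose V L \<epsilon> (Cod V h) ((h \<star> \<one>\<^bsub>A\<^esub> J) \<cdot>\<^bsub>A\<^esub> \<eta> P) = h"
    if h: "h \<in> Arr V" "Dom V h = omap L P" for h
  proof -
    have "\<epsilon> (Cod V h) \<cdot>\<^bsub>V\<^esub> amap L (h \<star> \<one>\<^bsub>A\<^esub> J) = h \<cdot>\<^bsub>V\<^esub> \<epsilon> (omap L P)"
      using adj.counit_natural[of h "omap L P" "Cod V h"] h by (simp add: hom_iff)
    from V.Comp_reduce[OF this] show ?thesis
      using h \<open>P \<in> Obj A\<close> by (simp add: transpose_def adj.triangle_left)
  qed
  show ?thesis using *[OF assms(3,5)] *[OF assms(4,6)] assms(1,7) by metis
qed

lemma psi_typing [simp]: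
  assumes "P \<in> Obj A" "Q \<in> Obj A"
  shows "\<psi> P Q \<in> Arr V" "Dom V (\<psi> P Q) = omap L (omap L P \<odot> Q)"
    "Cod V (\<psi> P Q) = omap L P \<otimes>\<^bsub>V\<^esub> omap L Q"
  using assms by (simp_all add: gamma_tilde_def transpose_def)

lemma psi0_typing [simp]:
  shows "\<psi>\<^sub>0 \<in> Arr V" "Dom V \<psi>\<^sub>0 = omap L J" "Cod V \<psi>\<^sub>0 = I"
  by (simp_all add: transpose_def)

text \<open>The equation characterising \<open>\<psi>\<close>. It is also the axiom \<open>\<gamma> P Q J \<cdot> \<rho> = P \<lhd> \<rho> Q\<close> of the induced
  structure.\<close>

lemma psi_flat:
  assumes "P \<in> Obj A" "Q \<in> Obj A"
  shows "m (omap L P) (omap L Q) J \<cdot>\<^bsub>A\<^esub> (\<psi> P Q \<star> \<one>\<^bsub>A\<^esub> J) \<cdot>\<^bsub>A\<^esub> \<eta> (omap L P \<odot> Q)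
    = \<one>\<^bsub>V\<^esub> (omap L P) \<star> \<eta> Q"
  using assms unfolding gamma_tilde_def by (subst flat_transpose) auto

text \<open>Likewise for \<open>\<psi>\<^sub>0\<close>; this is the axiom \<open>\<lambda> J \<cdot> \<rho> J = 1\<close>.\<close>

lemma psi0_flat: "u J \<cdot>\<^bsub>A\<^esub> (\<psi>\<^sub>0 \<star> \<one>\<^bsub>A\<^esub> J) \<cdot>\<^bsub>A\<^esub> \<eta> J = \<one>\<^bsub>A\<^esub> J"
  by (subst flat_transpose) auto

text \<open>The form in which equations between arrows \<open>L P \<rightarrow> X \<otimes> Y\<close> are proved: composing the flats with \<open>m\<close>
  brings the action axioms and \<open>psi_flat\<close> within reach.\<close>

lemma flat_m_inject:
  assumes "m X Y J \<cdot>\<^bsub>A\<^esub> (f \<star> \<one>\<^bsub>A\<^esub> J) \<cdot>\<^bsub>A\<^esub> \<eta> P = m X Y J \<cdot>\<^bsub>A\<^esub> (g \<star> \<one>\<^bsub>A\<^esub> J) \<cdot>\<^bsub>A\<^esub> \<eta> P"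
    "P \<in> Obj A" "f \<in> Arr V" "g \<in> Arr V" "Dom V f = omap L P" "Dom V g = omap L P"
    "Cod V f = X \<otimes>\<^bsub>V\<^esub> Y" "Cod V g = X \<otimes>\<^bsub>V\<^esub> Y" "X \<in> Obj V" "Y \<in> Obj V"
  shows "f = g"
proof (rule flat_inject)
  show "(f \<star> \<one>\<^bsub>A\<^esub> J) \<cdot>\<^bsub>A\<^esub> \<eta> P = (g \<star> \<one>\<^bsub>A\<^esub> J) \<cdot>\<^bsub>A\<^esub> \<eta> P"
    by (rule m_cancel[of X Y J]) (use assms in auto)
qed (use assms in auto)

section \<open>Oplax structure of the left adjoint\<close>

text \<open>Each rule comes also in the version for the middle of a composite. Naturality is oriented so that
  \<open>m\<close> moves right and \<open>\<eta>\<close> moves left, towards the \<open>\<psi>\<close> between them, until \<open>psi_flat\<close> applies.\<close>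

lemmas unit_move = unit_nat unit_nat[THEN A.Comp_reduce]
lemmas m_move = m_whisker m_whisker[THEN A.Comp_reduce]
lemmas psi_move = psi_flat psi_flat[THEN A.Comp_reduce3]
lemmas act_interchange = act.interchange act.interchange[THEN A.Comp_reduce]
lemmas act_assoc_move = act_assoc act_assoc[THEN A.Comp_reduce3]

lemma u_nat:
  assumes "h \<in> Arr A" "Cod A h = P"
  shows "u P \<cdot>\<^bsub>A\<^esub> (\<one>\<^bsub>V\<^esub> I \<star> h) = h \<cdot>\<^bsub>A\<^esub> u (Dom A h)"
  using u_natural[of h "Dom A h" P] assms by (simp add: hom_iff)

lemmas u_move = u_nat u_nat[THEN A.Comp_reduce]

lemma whisker_psi0_flat:
  assumes "X \<in> Obj V"
  shows "(\<one>\<^bsub>V\<^esub> X \<star> u J) \<cdot>\<^bsub>A\<^esub> (\<one>\<^bsub>V\<^esub> X \<star> \<psi>\<^sub>0 \<star> \<one>\<^bsub>A\<^esub> J) \<cdot>\<^bsub>A\<^esub> (\<one>\<^bsub>V\<^esub> X \<star> \<eta> J) = \<one>\<^bsub>A\<^esub> (X \<odot> J)"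
  using arg_cong[OF psi0_flat, of "amap act \<circ> Pair (\<one>\<^bsub>V\<^esub> X)"] assms by simp

lemma whisker_psi_flat:
  assumes "X \<in> Obj V" "P \<in> Obj A" "Q \<in> Obj A"
  shows "(\<one>\<^bsub>V\<^esub> X \<star> m (omap L P) (omap L Q) J) \<cdot>\<^bsub>A\<^esub> (\<one>\<^bsub>V\<^esub> X \<star> \<psi> P Q \<star> \<one>\<^bsub>A\<^esub> J)
      \<cdot>\<^bsub>A\<^esub> (\<one>\<^bsub>V\<^esub> X \<star> \<eta> (omap L P \<odot> Q)) = \<one>\<^bsub>V\<^esub> X \<star> \<one>\<^bsub>V\<^esub> (omap L P) \<star> \<eta> Q"
  using arg_cong[OF psi_flat[OF assms(2,3)], of "amap act \<circ> Pair (\<one>\<^bsub>V\<^esub> X)"] assms by simp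

lemma whisker_unit_nat:
  assumes "X \<in> Obj V" "f \<in> Arr A" "Dom A f = P"
  shows "(\<one>\<^bsub>V\<^esub> X \<star> amap L f \<star> \<one>\<^bsub>A\<^esub> J) \<cdot>\<^bsub>A\<^esub> (\<one>\<^bsub>V\<^esub> X \<star> \<eta> P) =
    (\<one>\<^bsub>V\<^esub> X \<star> \<eta> (Cod A f)) \<cdot>\<^bsub>A\<^esub> (\<one>\<^bsub>V\<^esub> X \<star> f)"
  using arg_cong[OF unit_nat[OF assms(2,3)], of "amap act \<circ> Pair (\<one>\<^bsub>V\<^esub> X)"] assms by auto

text \<open>Composed with \<open>(L P * u J) \<cdot> m\<close>, the flats of both sides are \<open>\<eta> P\<close>: the left one because
  \<open>u J\<close>, \<open>\<psi>\<^sub>0\<close> and \<open>\<eta> J\<close> cancel by \<open>psi0_flat\<close>, the right one by the unit axiom of the action for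
  \<open>runit\<close>.\<close>

lemma psi_runit:
  assumes [simp]: "P \<in> Obj A"
  shows "(\<one>\<^bsub>V\<^esub> (omap L P) \<boxtimes>\<^bsub>V\<^esub> \<psi>\<^sub>0) \<cdot>\<^bsub>V\<^esub> \<psi> P J \<cdot>\<^bsub>V\<^esub> amap L (\<eta> P) = runit V (omap L P)"
    (is "?lhs = ?rhs")
proof (rule flat_m_inject[of "omap L P" I])
  show "m (omap L P) I J \<cdot>\<^bsub>A\<^esub> (?lhs \<star> \<one>\<^bsub>A\<^esub> J) \<cdot>\<^bsub>A\<^esub> \<eta> P = m (omap L P) I J \<cdot>\<^bsub>A\<^esub> (?rhs \<star> \<one>\<^bsub>A\<^esub> J) \<cdot>\<^bsub>A\<^esub> \<eta> P"
  proof (rule A.iso_arrow_cancel_left[OF whisker_iso[OF u_iso]])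
    have "(\<one>\<^bsub>V\<^esub> (omap L P) \<star> u J) \<cdot>\<^bsub>A\<^esub> m (omap L P) I J \<cdot>\<^bsub>A\<^esub> (?lhs \<star> \<one>\<^bsub>A\<^esub> J) \<cdot>\<^bsub>A\<^esub> \<eta> P = \<eta> P"
      by (simp add: m_move unit_move psi_move whisker_psi0_flat[THEN A.Comp_reduce3])
    also have "\<eta> P = (\<one>\<^bsub>V\<^esub> (omap L P) \<star> u J) \<cdot>\<^bsub>A\<^esub> m (omap L P) I J \<cdot>\<^bsub>A\<^esub> (?rhs \<star> \<one>\<^bsub>A\<^esub> J) \<cdot>\<^bsub>A\<^esub> \<eta> P"
      by (simp add: act_runit[THEN A.Comp_reduce3])
    finally show "(\<one>\<^bsub>V\<^esub> (omap L P) \<star> u J) \<cdot>\<^bsub>A\<^esub> m (omap L P) I J \<cdot>\<^bsub>A\<^esub> (?lhs \<star> \<one>\<^bsub>A\<^esub> J) \<cdot>\<^bsub>A\<^esub> \<eta> P = \<dots>" .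
  qed simp_all
qed simp_all

text \<open>Both flats equal \<open>\<eta> P \<cdot> u P \<cdot> (\<psi>\<^sub>0 * P)\<close>; on the left \<open>lunit * J\<close> is replaced by \<open>u \<cdot> m\<close>, after
  which \<open>m\<close> moves to \<open>\<psi>\<close> and \<open>psi_flat\<close> applies.\<close>

lemma psi_lunit:
  assumes [simp]: "P \<in> Obj A"
  shows "lunit V (omap L P) \<cdot>\<^bsub>V\<^esub> (\<psi>\<^sub>0 \<boxtimes>\<^bsub>V\<^esub> \<one>\<^bsub>V\<^esub> (omap L P)) \<cdot>\<^bsub>V\<^esub> \<psi> J P
    = amap L (u P \<cdot>\<^bsub>A\<^esub> (\<psi>\<^sub>0 \<star> \<one>\<^bsub>A\<^esub> P))"
  by (rule flat_inject[of _ "omap L J \<odot> P"])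
    (simp_all add: unit_move m_move psi_move act_interchange u_move flip: act_lunit)

text \<open>Composed with \<open>(L P * m) \<cdot> m\<close>, both flats become \<open>(L P * (L Q * \<eta> R)) \<cdot> \<gamma> P Q R\<close>: the left one by
  two uses of \<open>psi_flat\<close>, the right one by the associativity axiom of the action and one use.\<close>

lemma psi_assoc:
  assumes [simp]: "P \<in> Obj A" "Q \<in> Obj A" "R \<in> Obj A"
  shows "(\<one>\<^bsub>V\<^esub> (omap L P) \<boxtimes>\<^bsub>V\<^esub> \<psi> Q R) \<cdot>\<^bsub>V\<^esub> \<psi> P (omap L Q \<odot> R)
      \<cdot>\<^bsub>V\<^esub> amap L (m (omap L P) (omap L Q) R \<cdot>\<^bsub>A\<^esub> (\<psi> P Q \<star> \<one>\<^bsub>A\<^esub> R))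
    = assoc V (omap L P) (omap L Q) (omap L R) \<cdot>\<^bsub>V\<^esub> (\<psi> P Q \<boxtimes>\<^bsub>V\<^esub> \<one>\<^bsub>V\<^esub> (omap L R))
      \<cdot>\<^bsub>V\<^esub> \<psi> (omap L P \<odot> Q) R" (is "?lhs = ?rhs")
proof (rule flat_m_inject[of "omap L P" "omap L Q \<otimes>\<^bsub>V\<^esub> omap L R"])
  let ?m = "m (omap L P) (omap L Q \<otimes>\<^bsub>V\<^esub> omap L R) J"
  let ?\<eta> = "\<eta> (omap L (omap L P \<odot> Q) \<odot> R)"
  show "?m \<cdot>\<^bsub>A\<^esub> (?lhs \<star> \<one>\<^bsub>A\<^esub> J) \<cdot>\<^bsub>A\<^esub> ?\<eta> = ?m \<cdot>\<^bsub>A\<^esub> (?rhs \<star> \<one>\<^bsub>A\<^esub> J) \<cdot>\<^bsub>A\<^esub> ?\<eta>"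
    by (rule A.iso_arrow_cancel_left[OF whisker_iso[OF m_iso[of "omap L Q" "omap L R" J]], of "omap L P"])
      (simp_all add: m_move unit_move psi_move act_assoc_move act_interchange
        whisker_psi_flat[THEN A.Comp_reduce3])
qed simp_all

lemma psi_nat:
  assumes [simp]: "f \<in> Arr A" "g \<in> Arr A"
  shows "\<psi> (Cod A f) (Cod A g) \<cdot>\<^bsub>V\<^esub> amap L (amap L f \<star> g)
    = (amap L f \<boxtimes>\<^bsub>V\<^esub> amap L g) \<cdot>\<^bsub>V\<^esub> \<psi> (Dom A f) (Dom A g)"
  by (rule flat_m_inject[of "omap L (Cod A f)" "omap L (Cod A g)" _ "omap L (Dom A f) \<odot> Dom A g"])
    (simp_all add: unit_move psi_move m_move act_interchange act.decompose[of "amap L f" g]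
      tensor.decompose[of "amap L f" "amap L g"] whisker_unit_nat[THEN A.Comp_reduce])

section \<open>Induced left skew monoidal structure\<close>

text \<open>The letter \<open>\<lambda>\<close> being reserved for abstraction, \<open>lam\<close> is the induced left unit constraint.\<close>

abbreviation \<gamma> where "\<gamma> P Q R \<equiv> m (omap L P) (omap L Q) R \<cdot>\<^bsub>A\<^esub> (\<psi> P Q \<star> \<one>\<^bsub>A\<^esub> R)"
abbreviation lam where "lam P \<equiv> u P \<cdot>\<^bsub>A\<^esub> (\<psi>\<^sub>0 \<star> \<one>\<^bsub>A\<^esub> P)"

lemma gamma_nat:
  assumes [simp]: "f \<in> Arr A" "g \<in> Arr A" "h \<in> Arr A"
  shows "\<gamma> (Cod A f) (Cod A g) (Cod A h) \<cdot>\<^bsub>A\<^esub> (amap L (amap L f \<star> g) \<star> h)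
    = (amap L f \<star> amap L g \<star> h) \<cdot>\<^bsub>A\<^esub> \<gamma> (Dom A f) (Dom A g) (Dom A h)"
proof -
  have "\<gamma> (Cod A f) (Cod A g) (Cod A h) \<cdot>\<^bsub>A\<^esub> (amap L (amap L f \<star> g) \<star> h)
    = m (omap L (Cod A f)) (omap L (Cod A g)) (Cod A h) \<cdot>\<^bsub>A\<^esub>
      ((\<psi> (Cod A f) (Cod A g) \<cdot>\<^bsub>V\<^esub> amap L (amap L f \<star> g)) \<star> h)"
    by (simp add: act.bi_Comp del: act.whisker_Comp)
  also have "\<dots> = m (omap L (Cod A f)) (omap L (Cod A g)) (Cod A h) \<cdot>\<^bsub>A\<^esub>
      ((amap L f \<boxtimes>\<^bsub>V\<^esub> amap L g) \<star> h) \<cdot>\<^bsub>A\<^esub> (\<psi> (Dom A f) (Dom A g) \<star> \<one>\<^bsub>A\<^esub> (Dom A h))"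
    by (simp add: psi_nat act.bi_Comp del: act.whisker_Comp)
  also have "\<dots> = (amap L f \<star> amap L g \<star> h) \<cdot>\<^bsub>A\<^esub> \<gamma> (Dom A f) (Dom A g) (Dom A h)"
    using m_natural[of "amap L f" _ _ "amap L g" _ _ h, THEN A.Comp_reduce]
    by (simp add: hom_iff)
  finally show ?thesis .
qed

text \<open>The oplax associativity axiom, acting on \<open>S\<close>, turns the left side into one of the form
  \<open>(L P * m) \<cdot> m \<cdot> (assoc * S) \<cdot> ...\<close>, where the associativity axiom of the action applies.\<close>

lemma gamma_pentagon:
  assumes [simp]: "P \<in> Obj A" "Q \<in> Obj A" "R \<in> Obj A" "S \<in> Obj A"
  shows "(\<one>\<^bsub>V\<^esub> (omap L P) \<star> \<gamma> Q R S) \<cdot>\<^bsub>A\<^esub> \<gamma> P (omap L Q \<odot> R) S \<cdot>\<^bsub>A\<^esub> (amap L (\<gamma> P Q R) \<star> \<one>\<^bsub>A\<^esub> S)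
    = \<gamma> P Q (omap L R \<odot> S) \<cdot>\<^bsub>A\<^esub> \<gamma> (omap L P \<odot> Q) R S"
    (is "?lhs = ?rhs")
proof -
  have "?lhs = (\<one>\<^bsub>V\<^esub> (omap L P) \<star> m (omap L Q) (omap L R) S)
      \<cdot>\<^bsub>A\<^esub> m (omap L P) (omap L Q \<otimes>\<^bsub>V\<^esub> omap L R) S
      \<cdot>\<^bsub>A\<^esub> (((\<one>\<^bsub>V\<^esub> (omap L P) \<boxtimes>\<^bsub>V\<^esub> \<psi> Q R) \<cdot>\<^bsub>V\<^esub> \<psi> P (omap L Q \<odot> R) \<cdot>\<^bsub>V\<^esub> amap L (\<gamma> P Q R)) \<star> \<one>\<^bsub>A\<^esub> S)"
    by (simp add: m_move)
  also have "\<dots> = ?rhs"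
    unfolding psi_assoc[OF assms(1-3)] by (simp add: act_assoc_move m_move)
  finally show ?thesis .
qed

text \<open>The oplax axiom for \<open>lunit\<close>, acting on \<open>Q\<close>, with \<open>lunit * Q = u \<cdot> m\<close>.\<close>

lemma lambda_gamma:
  assumes [simp]: "P \<in> Obj A" "Q \<in> Obj A"
  shows "lam (omap L P \<odot> Q) \<cdot>\<^bsub>A\<^esub> \<gamma> J P Q = amap L (lam P) \<star> \<one>\<^bsub>A\<^esub> Q"
proof -
  have "amap L (lam P) \<star> \<one>\<^bsub>A\<^esub> Q =
      (lunit V (omap L P) \<cdot>\<^bsub>V\<^esub> (\<psi>\<^sub>0 \<boxtimes>\<^bsub>V\<^esub> \<one>\<^bsub>V\<^esub> (omap L P)) \<cdot>\<^bsub>V\<^esub> \<psi> J P) \<star> \<one>\<^bsub>A\<^esub> Q"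
    by (simp only: psi_lunit assms)
  also have "\<dots> = lam (omap L P \<odot> Q) \<cdot>\<^bsub>A\<^esub> \<gamma> J P Q"
    by (simp add: m_move flip: act_lunit)
  finally show ?thesis ..
qed

text \<open>The oplax axiom for \<open>runit\<close>, acting on \<open>Q\<close>, makes the left side the left side of the unit
  axiom of the action for \<open>runit\<close>.\<close>

lemma gamma_triangle:
  assumes [simp]: "P \<in> Obj A" "Q \<in> Obj A"
  shows "(\<one>\<^bsub>V\<^esub> (omap L P) \<star> lam Q) \<cdot>\<^bsub>A\<^esub> \<gamma> P J Q \<cdot>\<^bsub>A\<^esub> (amap L (\<eta> P) \<star> \<one>\<^bsub>A\<^esub> Q) = \<one>\<^bsub>A\<^esub> (omap L P \<odot> Q)"
proof -
  have "(\<one>\<^bsub>V\<^esub> (omap L P) \<star> lam Q) \<cdot>\<^bsub>A\<^esub> \<gamma> P J Q \<cdot>\<^bsub>A\<^esub> (amap L (\<eta> P) \<star> \<one>\<^bsub>A\<^esub> Q)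
    = (\<one>\<^bsub>V\<^esub> (omap L P) \<star> u Q) \<cdot>\<^bsub>A\<^esub> m (omap L P) I Q \<cdot>\<^bsub>A\<^esub>
      (((\<one>\<^bsub>V\<^esub> (omap L P) \<boxtimes>\<^bsub>V\<^esub> \<psi>\<^sub>0) \<cdot>\<^bsub>V\<^esub> \<psi> P J \<cdot>\<^bsub>V\<^esub> amap L (\<eta> P)) \<star> \<one>\<^bsub>A\<^esub> Q)"
    by (simp add: m_move)
  also have "\<dots> = \<one>\<^bsub>A\<^esub> (omap L P \<odot> Q)"
    by (simp only: psi_runit assms act_runit adj.L.omap_in)
  finally show ?thesis .
qed

abbreviation AJ where "AJ \<equiv> induced_skew_monoidal V A act m u J L \<eta> \<epsilon>"

lemma AJ_simps [simp]:
  "Obj AJ = Obj A" "Arr AJ = Arr A" "Dom AJ = Dom A" "Cod AJ = Cod A" "Ident AJ = Ident A" "Comp AJ = Comp A"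
  "omap (tensor AJ) (P, Q) = omap L P \<odot> Q"
  "amap (tensor AJ) (f, g) = amap L f \<star> g"
  "unit_ob AJ = J" "assoc AJ P Q R = \<gamma> P Q R" "runit AJ = \<eta>"
  by (simp_all add: induced_skew_monoidal_def)

lemma AJ_lunit [simp]: "P \<in> Obj A \<Longrightarrow> lunit AJ P = lam P"
  by (simp add: induced_skew_monoidal_def transpose_def)

lemma skew_AJ: "left_skew_monoidal AJ"
proof -
  interpret AJ: category AJ by unfold_locales (auto simp: hom_iff)
  interpret AJ2: category "prod_cat AJ AJ" by unfold_locales (auto simp: hom_iff)
  interpret tensor_AJ: is_functor "prod_cat AJ AJ" AJ "tensor AJ"
    by unfold_locales (auto simp: hom_iff act.bi_Comp simp del: act.whisker_Comp)
  show ?thesis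
  proof unfold_locales
    fix P P' f
    show "f \<in> hom AJ P P' \<Longrightarrow> lunit AJ P' \<cdot>\<^bsub>AJ\<^esub> (\<one>\<^bsub>AJ\<^esub> (unit_ob AJ) \<boxtimes>\<^bsub>AJ\<^esub> f) = f \<cdot>\<^bsub>AJ\<^esub> lunit AJ P"
      by (auto simp: hom_iff act_interchange u_move)
  next
    fix P P' f
    show "f \<in> hom AJ P P' \<Longrightarrow> runit AJ P' \<cdot>\<^bsub>AJ\<^esub> f = (f \<boxtimes>\<^bsub>AJ\<^esub> \<one>\<^bsub>AJ\<^esub> (unit_ob AJ)) \<cdot>\<^bsub>AJ\<^esub> runit AJ P"
      by (auto simp: hom_iff unit_nat)
  next
    fix P Q R S
    assume "P \<in> Obj AJ" "Q \<in> Obj AJ" "R \<in> Obj AJ" "S \<in> Obj AJ"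
    then show "(\<one>\<^bsub>AJ\<^esub> P \<boxtimes>\<^bsub>AJ\<^esub> assoc AJ Q R S) \<cdot>\<^bsub>AJ\<^esub> assoc AJ P (Q \<otimes>\<^bsub>AJ\<^esub> R) S
        \<cdot>\<^bsub>AJ\<^esub> (assoc AJ P Q R \<boxtimes>\<^bsub>AJ\<^esub> \<one>\<^bsub>AJ\<^esub> S)
      = assoc AJ P Q (R \<otimes>\<^bsub>AJ\<^esub> S) \<cdot>\<^bsub>AJ\<^esub> assoc AJ (P \<otimes>\<^bsub>AJ\<^esub> Q) R S"
      using gamma_pentagon[of P Q R S] by simp
  next
    fix P Q
    assume "P \<in> Obj AJ" "Q \<in> Obj AJ"
    then show "lunit AJ (P \<otimes>\<^bsub>AJ\<^esub> Q) \<cdot>\<^bsub>AJ\<^esub> assoc AJ (unit_ob AJ) P Q = lunit AJ P \<boxtimes>\<^bsub>AJ\<^esub> \<one>\<^bsub>AJ\<^esub> Q"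
      and "(\<one>\<^bsub>AJ\<^esub> P \<boxtimes>\<^bsub>AJ\<^esub> lunit AJ Q) \<cdot>\<^bsub>AJ\<^esub> assoc AJ P (unit_ob AJ) Q \<cdot>\<^bsub>AJ\<^esub> (runit AJ P \<boxtimes>\<^bsub>AJ\<^esub> \<one>\<^bsub>AJ\<^esub> Q)
        = \<one>\<^bsub>AJ\<^esub> (P \<otimes>\<^bsub>AJ\<^esub> Q)"
      using lambda_gamma[of P Q] gamma_triangle[of P Q] by simp_all
  qed (use gamma_nat in \<open>auto simp: hom_iff psi_flat psi0_flat\<close>)
qed

section \<open>Lax structure of the right adjoint\<close>

abbreviation \<phi> where "\<phi> X Y \<equiv> inv_arrow A (m X Y J) \<cdot>\<^bsub>A\<^esub> (\<epsilon> X \<star> \<one>\<^bsub>A\<^esub> (Y \<odot> J))"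

lemma phi_nat:
  assumes [simp]: "f \<in> Arr V" "g \<in> Arr V"
  shows "\<phi> (Cod V f) (Cod V g) \<cdot>\<^bsub>A\<^esub> (amap L (f \<star> \<one>\<^bsub>A\<^esub> J) \<star> g \<star> \<one>\<^bsub>A\<^esub> J)
    = ((f \<boxtimes>\<^bsub>V\<^esub> g) \<star> \<one>\<^bsub>A\<^esub> J) \<cdot>\<^bsub>A\<^esub> \<phi> (Dom V f) (Dom V g)"
proof (rule m_cancel[of "Cod V f" "Cod V g" J])
  have "\<epsilon> (Cod V f) \<cdot>\<^bsub>V\<^esub> amap L (f \<star> \<one>\<^bsub>A\<^esub> J) = f \<cdot>\<^bsub>V\<^esub> \<epsilon> (Dom V f)"
    using adj.counit_natural[of f] by (simp add: hom_iff)
  then have "(\<epsilon> (Cod V f) \<star> \<one>\<^bsub>A\<^esub> (Cod V g \<odot> J)) \<cdot>\<^bsub>A\<^esub> (amap L (f \<star> \<one>\<^bsub>A\<^esub> J) \<star> g \<star> \<one>\<^bsub>A\<^esub> J)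
    = (f \<star> g \<star> \<one>\<^bsub>A\<^esub> J) \<cdot>\<^bsub>A\<^esub> (\<epsilon> (Dom V f) \<star> \<one>\<^bsub>A\<^esub> (Dom V g \<odot> J))"
    by (simp add: act.bi_Comp del: act.whisker_Comp)
  then show "m (Cod V f) (Cod V g) J \<cdot>\<^bsub>A\<^esub> \<phi> (Cod V f) (Cod V g) \<cdot>\<^bsub>A\<^esub> (amap L (f \<star> \<one>\<^bsub>A\<^esub> J) \<star> g \<star> \<one>\<^bsub>A\<^esub> J)
    = m (Cod V f) (Cod V g) J \<cdot>\<^bsub>A\<^esub> ((f \<boxtimes>\<^bsub>V\<^esub> g) \<star> \<one>\<^bsub>A\<^esub> J) \<cdot>\<^bsub>A\<^esub> \<phi> (Dom V f) (Dom V g)"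
    using m_natural[of f _ _ g _ _ "\<one>\<^bsub>A\<^esub> J", THEN A.Comp_reduce] by (simp add: hom_iff)
qed simp_all

text \<open>The counit is compatible with \<open>\<phi>\<close> and \<open>\<psi>\<close>: this is \<open>(\<epsilon> X \<otimes> \<epsilon> Y) \<cdot> \<psi> = \<epsilon> (X \<otimes> Y) \<cdot> L (\<phi> X Y)\<close> with the
  tensor of arrows split into whiskerings. Composed with \<open>m\<close>, both flats are \<open>\<epsilon> X * (Y * J)\<close>.\<close>

lemma counit_psi:
  assumes [simp]: "X \<in> Obj V" "Y \<in> Obj V"
  shows "(\<one>\<^bsub>V\<^esub> X \<boxtimes>\<^bsub>V\<^esub> \<epsilon> Y) \<cdot>\<^bsub>V\<^esub> (\<epsilon> X \<boxtimes>\<^bsub>V\<^esub> \<one>\<^bsub>V\<^esub> (omap L (Y \<odot> J))) \<cdot>\<^bsub>V\<^esub> \<psi> (X \<odot> J) (Y \<odot> J)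
    = transpose V L \<epsilon> (X \<otimes>\<^bsub>V\<^esub> Y) (\<phi> X Y)" (is "?lhs = ?rhs")
proof (rule flat_m_inject[of X Y])
  have t: "(\<one>\<^bsub>V\<^esub> X \<star> \<epsilon> Y \<star> \<one>\<^bsub>A\<^esub> J) \<cdot>\<^bsub>A\<^esub> (\<one>\<^bsub>V\<^esub> X \<star> \<eta> (Y \<odot> J)) = \<one>\<^bsub>A\<^esub> (X \<odot> Y \<odot> J)"
    using arg_cong[OF adj.triangle_right[of Y], of "amap act \<circ> Pair (\<one>\<^bsub>V\<^esub> X)"] by simp
  have "m X Y J \<cdot>\<^bsub>A\<^esub> (?lhs \<star> \<one>\<^bsub>A\<^esub> J) \<cdot>\<^bsub>A\<^esub> \<eta> (omap L (X \<odot> J) \<odot> Y \<odot> J) = \<epsilon> X \<star> \<one>\<^bsub>A\<^esub> (Y \<odot> J)"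
    by (simp add: m_move psi_move act_interchange t t[THEN A.Comp_reduce])
  also have "\<dots> = m X Y J \<cdot>\<^bsub>A\<^esub> (?rhs \<star> \<one>\<^bsub>A\<^esub> J) \<cdot>\<^bsub>A\<^esub> \<eta> (omap L (X \<odot> J) \<odot> Y \<odot> J)"
    by (subst flat_transpose) simp_all
  finally show "m X Y J \<cdot>\<^bsub>A\<^esub> (?lhs \<star> \<one>\<^bsub>A\<^esub> J) \<cdot>\<^bsub>A\<^esub> \<eta> (omap L (X \<odot> J) \<odot> Y \<odot> J) = \<dots>" .
qed (simp_all add: transpose_def)

text \<open>Here \<open>lunit * J = u \<cdot> m\<close> cancels the inverse of \<open>m\<close> in \<open>\<phi>\<close>, leaving \<open>\<lambda>\<close> with \<open>\<psi>\<^sub>0\<close> spelled out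
  as a composite.\<close>

lemma phi_lunit:
  assumes [simp]: "X \<in> Obj V"
  shows "(lunit V X \<star> \<one>\<^bsub>A\<^esub> J) \<cdot>\<^bsub>A\<^esub> \<phi> I X \<cdot>\<^bsub>A\<^esub> (amap L (inv_arrow A (u J)) \<star> \<one>\<^bsub>A\<^esub> (X \<odot> J)) = lam (X \<odot> J)"
  by (simp add: transpose_def flip: act_lunit)

text \<open>After composing with \<open>(X * u J) \<cdot> m\<close> both sides are identities, by a triangle identity on the left and
  the unit axiom of the action for \<open>runit\<close> on the right.\<close>

lemma phi_runit:
  assumes [simp]: "X \<in> Obj V"
  shows "\<phi> X I \<cdot>\<^bsub>A\<^esub> (\<one>\<^bsub>V\<^esub> (omap L (X \<odot> J)) \<star> inv_arrow A (u J)) \<cdot>\<^bsub>A\<^esub> \<eta> (X \<odot> J) = runit V X \<star> \<one>\<^bsub>A\<^esub> J"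
    (is "?lhs = ?rhs")
proof (rule m_cancel[of X I J])
  show "m X I J \<cdot>\<^bsub>A\<^esub> ?lhs = m X I J \<cdot>\<^bsub>A\<^esub> ?rhs"
  proof (rule A.iso_arrow_cancel_left[OF whisker_iso[OF u_iso]])
    have u: "(\<one>\<^bsub>V\<^esub> X \<star> u J) \<cdot>\<^bsub>A\<^esub> (\<one>\<^bsub>V\<^esub> X \<star> inv_arrow A (u J)) = \<one>\<^bsub>A\<^esub> (X \<odot> J)"
      by (simp flip: act.whisker_Comp)
    have "(\<one>\<^bsub>V\<^esub> X \<star> u J) \<cdot>\<^bsub>A\<^esub> m X I J \<cdot>\<^bsub>A\<^esub> ?lhs = \<one>\<^bsub>A\<^esub> (X \<odot> J)"
      using adj.triangle_right[of X] by (simp add: act_interchange u u[THEN A.Comp_reduce])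
    also have "\<dots> = (\<one>\<^bsub>V\<^esub> X \<star> u J) \<cdot>\<^bsub>A\<^esub> m X I J \<cdot>\<^bsub>A\<^esub> ?rhs"
      by (simp add: act_runit)
    finally show "(\<one>\<^bsub>V\<^esub> X \<star> u J) \<cdot>\<^bsub>A\<^esub> m X I J \<cdot>\<^bsub>A\<^esub> ?lhs = \<dots>" .
  qed simp_all
qed simp_all

text \<open>After composing with \<open>(X * m) \<cdot> m\<close> both sides are \<open>m\<close> after the two sides of \<open>counit_psi\<close>, acting on
  \<open>Z * J\<close>.\<close>

lemma phi_assoc:
  assumes [simp]: "X \<in> Obj V" "Y \<in> Obj V" "Z \<in> Obj V"
  shows "\<phi> X (Y \<otimes>\<^bsub>V\<^esub> Z) \<cdot>\<^bsub>A\<^esub> (\<one>\<^bsub>V\<^esub> (omap L (X \<odot> J)) \<star> \<phi> Y Z) \<cdot>\<^bsub>A\<^esub> \<gamma> (X \<odot> J) (Y \<odot> J) (Z \<odot> J)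
    = (assoc V X Y Z \<star> \<one>\<^bsub>A\<^esub> J) \<cdot>\<^bsub>A\<^esub> \<phi> (X \<otimes>\<^bsub>V\<^esub> Y) Z \<cdot>\<^bsub>A\<^esub> (amap L (\<phi> X Y) \<star> \<one>\<^bsub>A\<^esub> (Z \<odot> J))"
    (is "?lhs = ?rhs")
proof (rule m_cancel[of X "Y \<otimes>\<^bsub>V\<^esub> Z" J])
  show "m X (Y \<otimes>\<^bsub>V\<^esub> Z) J \<cdot>\<^bsub>A\<^esub> ?lhs = m X (Y \<otimes>\<^bsub>V\<^esub> Z) J \<cdot>\<^bsub>A\<^esub> ?rhs"
  proof (rule A.iso_arrow_cancel_left[OF whisker_iso[OF m_iso[of Y Z J]], of X])
    have mm: "(\<one>\<^bsub>V\<^esub> X \<star> m Y Z J) \<cdot>\<^bsub>A\<^esub> (\<one>\<^bsub>V\<^esub> X \<star> inv_arrow A (m Y Z J)) = \<one>\<^bsub>A\<^esub> (X \<odot> Y \<odot> Z \<odot> J)"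
      by (simp flip: act.whisker_Comp)
    have "(\<one>\<^bsub>V\<^esub> X \<star> m Y Z J) \<cdot>\<^bsub>A\<^esub> m X (Y \<otimes>\<^bsub>V\<^esub> Z) J \<cdot>\<^bsub>A\<^esub> ?lhs
      = m X Y (Z \<odot> J) \<cdot>\<^bsub>A\<^esub> (((\<one>\<^bsub>V\<^esub> X \<boxtimes>\<^bsub>V\<^esub> \<epsilon> Y) \<cdot>\<^bsub>V\<^esub> (\<epsilon> X \<boxtimes>\<^bsub>V\<^esub> \<one>\<^bsub>V\<^esub> (omap L (Y \<odot> J)))
          \<cdot>\<^bsub>V\<^esub> \<psi> (X \<odot> J) (Y \<odot> J)) \<star> \<one>\<^bsub>A\<^esub> (Z \<odot> J))"
      by (simp add: m_move act_interchange mm mm[THEN A.Comp_reduce])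
    also have "\<dots> = m X Y (Z \<odot> J) \<cdot>\<^bsub>A\<^esub> (transpose V L \<epsilon> (X \<otimes>\<^bsub>V\<^esub> Y) (\<phi> X Y) \<star> \<one>\<^bsub>A\<^esub> (Z \<odot> J))"
      by (simp only: counit_psi assms)
    also have "\<dots> = (\<one>\<^bsub>V\<^esub> X \<star> m Y Z J) \<cdot>\<^bsub>A\<^esub> m X (Y \<otimes>\<^bsub>V\<^esub> Z) J \<cdot>\<^bsub>A\<^esub> ?rhs"
      by (simp add: transpose_def act_assoc_move)
    finally show "(\<one>\<^bsub>V\<^esub> X \<star> m Y Z J) \<cdot>\<^bsub>A\<^esub> m X (Y \<otimes>\<^bsub>V\<^esub> Z) J \<cdot>\<^bsub>A\<^esub> ?lhs = \<dots>" .
  qed simp_all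
qed simp_all

section \<open>The monoidal adjunction\<close>

lemma lax_AJ: "lax_monoidal V AJ (act_on A act J) \<phi> (inv_arrow A (u J))"
proof -
  interpret AJ: left_skew_monoidal AJ by (rule skew_AJ)
  interpret F: is_functor V AJ "act_on A act J" by unfold_locales (auto simp: hom_iff)
  show ?thesis
  proof unfold_locales
    fix X X' Y Y' f g
    assume "f \<in> hom V X X'" "g \<in> hom V Y Y'"
    then show "\<phi> X' Y' \<cdot>\<^bsub>AJ\<^esub> (amap (act_on A act J) f \<boxtimes>\<^bsub>AJ\<^esub> amap (act_on A act J) g)
      = amap (act_on A act J) (f \<boxtimes>\<^bsub>V\<^esub> g) \<cdot>\<^bsub>AJ\<^esub> \<phi> X Y"
      using phi_nat[of f g] by (auto simp: hom_iff)
  next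
    fix X Y Z
    assume "X \<in> Obj V" "Y \<in> Obj V" "Z \<in> Obj V"
    from phi_assoc[OF this]
    show "\<phi> X (Y \<otimes>\<^bsub>V\<^esub> Z) \<cdot>\<^bsub>AJ\<^esub> (\<one>\<^bsub>AJ\<^esub> (omap (act_on A act J) X) \<boxtimes>\<^bsub>AJ\<^esub> \<phi> Y Z)
        \<cdot>\<^bsub>AJ\<^esub> assoc AJ (omap (act_on A act J) X) (omap (act_on A act J) Y) (omap (act_on A act J) Z)
      = amap (act_on A act J) (assoc V X Y Z) \<cdot>\<^bsub>AJ\<^esub> \<phi> (X \<otimes>\<^bsub>V\<^esub> Y) Z
        \<cdot>\<^bsub>AJ\<^esub> (\<phi> X Y \<boxtimes>\<^bsub>AJ\<^esub> \<one>\<^bsub>AJ\<^esub> (omap (act_on A act J) Z))"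
      using \<open>X \<in> Obj V\<close> by (simp only: AJ_simps act_on_simps adj.L.amap_Ident act.omap_in prod_cat_simps
        mem_Sigma_iff J_in simp_thms)
  next
    fix X
    assume X: "X \<in> Obj V"
    show "amap (act_on A act J) (lunit V X) \<cdot>\<^bsub>AJ\<^esub> \<phi> (unit_ob V) X
        \<cdot>\<^bsub>AJ\<^esub> (inv_arrow A (u J) \<boxtimes>\<^bsub>AJ\<^esub> \<one>\<^bsub>AJ\<^esub> (omap (act_on A act J) X))
      = lunit AJ (omap (act_on A act J) X)"
      using phi_lunit[OF X] X by simp
    show "\<phi> X (unit_ob V) \<cdot>\<^bsub>AJ\<^esub> (\<one>\<^bsub>AJ\<^esub> (omap (act_on A act J) X) \<boxtimes>\<^bsub>AJ\<^esub> inv_arrow A (u J))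
        \<cdot>\<^bsub>AJ\<^esub> runit AJ (omap (act_on A act J) X)
      = amap (act_on A act J) (runit V X)"
      using phi_runit[OF X] X by simp
  qed (auto simp: hom_iff)
qed

lemma oplax_AJ: "oplax_monoidal AJ V L \<psi> \<psi>\<^sub>0"
proof -
  interpret AJ: left_skew_monoidal AJ by (rule skew_AJ)
  interpret L: is_functor AJ V L by unfold_locales (auto simp: hom_iff)
  show ?thesis
  proof unfold_locales
    fix P P' Q Q' f g
    assume "f \<in> hom AJ P P'" "g \<in> hom AJ Q Q'"
    then show "\<psi> P' Q' \<cdot>\<^bsub>V\<^esub> amap L (f \<boxtimes>\<^bsub>AJ\<^esub> g) = (amap L f \<boxtimes>\<^bsub>V\<^esub> amap L g) \<cdot>\<^bsub>V\<^esub> \<psi> P Q"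
      using psi_nat[of f g] by (auto simp: hom_iff)
  next
    fix P Q R
    assume "P \<in> Obj AJ" "Q \<in> Obj AJ" "R \<in> Obj AJ"
    then show "(\<one>\<^bsub>V\<^esub> (omap L P) \<boxtimes>\<^bsub>V\<^esub> \<psi> Q R) \<cdot>\<^bsub>V\<^esub> \<psi> P (Q \<otimes>\<^bsub>AJ\<^esub> R) \<cdot>\<^bsub>V\<^esub> amap L (assoc AJ P Q R)
      = assoc V (omap L P) (omap L Q) (omap L R) \<cdot>\<^bsub>V\<^esub>
        (\<psi> P Q \<boxtimes>\<^bsub>V\<^esub> \<one>\<^bsub>V\<^esub> (omap L R)) \<cdot>\<^bsub>V\<^esub> \<psi> (P \<otimes>\<^bsub>AJ\<^esub> Q) R"
      using psi_assoc[of P Q R] by simp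
  next
    fix P
    assume P: "P \<in> Obj AJ"
    then show "lunit V (omap L P) \<cdot>\<^bsub>V\<^esub> (\<psi>\<^sub>0 \<boxtimes>\<^bsub>V\<^esub> \<one>\<^bsub>V\<^esub> (omap L P)) \<cdot>\<^bsub>V\<^esub> \<psi> (unit_ob AJ) P = amap L (lunit AJ P)"
      using psi_lunit[of P] by simp
    show "(\<one>\<^bsub>V\<^esub> (omap L P) \<boxtimes>\<^bsub>V\<^esub> \<psi>\<^sub>0) \<cdot>\<^bsub>V\<^esub> \<psi> P (unit_ob AJ) \<cdot>\<^bsub>V\<^esub> amap L (runit AJ P) = runit V (omap L P)"
      using psi_runit[of P] P by simp
  qed (auto simp: hom_iff)
qed

text \<open>In \<open>\<phi> (L P) (L Q) \<cdot> (\<eta> P \<lhd> \<eta> Q)\<close> the first arguments compose to \<open>\<epsilon> (L P) \<cdot> L (\<eta> P) = 1\<close>, which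
  leaves the arrow that \<open>gamma_tilde\<close> transposes.\<close>

lemma mates_AJ: "mates AJ V L \<eta> \<epsilon> \<phi> (inv_arrow A (u J)) \<psi> \<psi>\<^sub>0"
proof -
  have "\<phi> (omap L P) (omap L Q) \<cdot>\<^bsub>A\<^esub> (amap L (\<eta> P) \<star> \<eta> Q)
    = inv_arrow A (m (omap L P) (omap L Q) J) \<cdot>\<^bsub>A\<^esub> (\<one>\<^bsub>V\<^esub> (omap L P) \<star> \<eta> Q)"
    if "P \<in> Obj A" "Q \<in> Obj A" for P Q
    using that by (simp add: act.bi_Comp adj.triangle_left)
  then show ?thesis by (simp add: mates_def gamma_tilde_def)
qed

end

theorem proposition4p1:
  fixes V :: "('o, 'a) skew_monoidal"
    and A :: "('p, 'b) cat"
    and act :: "('o \<times> 'p, 'a \<times> 'b, 'p, 'b) fctr"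
    and m :: "'o \<Rightarrow> 'o \<Rightarrow> 'p \<Rightarrow> 'b"
    and u :: "'p \<Rightarrow> 'b"
    and J :: 'p
    and L :: "('p, 'b, 'o, 'a) fctr"
    and \<eta> :: "'p \<Rightarrow> 'b"
    and \<epsilon> :: "'o \<Rightarrow> 'a"
  assumes "left_skew_monoidal V"
    and "strong_left_action V A act m u"
    and "J \<in> Obj A"
    and "adjunction A V L (act_on A act J) \<eta> \<epsilon>"
  shows "let AJ = induced_skew_monoidal V A act m u J L \<eta> \<epsilon> in
   \<exists>\<phi> \<iota> \<psi> \<psi>\<^sub>0.
    lax_monoidal V AJ (act_on A act J) \<phi> \<iota> \<and>
    oplax_monoidal AJ V L \<psi> \<psi>\<^sub>0 \<and>
    mates AJ V L \<eta> \<epsilon> \<phi> \<iota> \<psi> \<psi>\<^sub>0"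
proof -
  interpret action_with_adjoint V A act m u J L \<eta> \<epsilon>
    using assms by (intro action_with_adjoint.intro action_with_adjoint_axioms.intro)
  show ?thesis
    unfolding Let_def using lax_AJ oplax_AJ mates_AJ by blast
qed

end
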